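(* Let $\Gamma$ be a $C^2$, strictly convex, $\mathbb{D}_2$-symmetric billiard curve, and let $Z$ be one of its $\mathbb{D}_2$-symmetric $2$-periodic Birkhoff billiard orbits. Let $L=\|Z_{i+1}-Z_i\|$ and $\kappa=\kappa(Z_i)$; both are independent of $i$. Let $s\ge2$ be an integer and $p=2s$. If $\kappa L<2\cos^2(\pi/p)$, then $\Gamma$ admits a non-Birkhoff periodic billiard orbit $z$ of minimal period $p$ and rotation number $\frac12$ whose spatiotemporal symmetry group is $\langle\sigma\rangle$ for a single reflection $\sigma\in\{S,RS\}$. Moreover $z$ is of type V, meaning that $\sigma$ acts both time-preservingly and time-reversingly: $\sigma(z_i)=z_{p/2+i}$ for all $i$, and there is $k$ with $\sigma(z_i)=z_{k-i}$ for all $i$. Finally, there are lifts $x$ of $z$ and $X$ of $Z$ in $\mathbb{X}_{p,s}$ such that $x-X$ changes sign exactly $2$ times per period $p$.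
   Context: $\mathbb{D}_2=\langle R,S\rangle$, where $R$ is rotation by $\pi$ and $S$ is the reflection in the horizontal axis. A billiard curve is a $C^2$ simple closed curve $\Gamma$ bounding a strictly convex domain. It is parametrized counterclockwise by a $1$-periodic $C^2$ immersion $\gamma$ descending to an embedding of $\mathbb{R}/\mathbb{Z}$, and chosen equivariant: $\gamma(x+1/2)=R\gamma(x)$, $\gamma(-x)=S\gamma(x)$. $\kappa$ denotes curvature. A billiard sequence is $z\in\Gamma^{\mathbb{Z}}$ with $z_i\ne z_{i+1}$. It is a billiard orbit if the billiard reflection law holds at every $z_i$. Lifts $x$ satisfy $\gamma(x_i)=z_i$ and $0<x_{i+1}-x_i<1$. $\mathbb{X}_{p,q}=\{x:x_{i+p}=x_i+q\}$. A real sequence $x$ is Birkhoff if $x_i\le x_j+l\Rightarrow x_{i+m}\le x_{j+m}+l$ for all integers; a billiard sequence is Birkhoff iff its lift is. The spatiotemporal symmetry group $H(z)$ consists of all $h\in\mathbb{D}_2$ for which there is $k\in\mathbb{Z}$ with $h(z_i)=z_{k+i}$ for all $i$ (time-preserving) or $h(z_i)=z_{k-i}$ for all $i$ (time-reversing). $Z$ is $\mathbb{D}_2$-symmetric if $H(Z)=\mathbb{D}_2$. *)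

theory Defs
  imports "HOL-Complex_Analysis.Complex_Analysis"
begin

definition rotR :: "complex \<Rightarrow> complex" where "rotR w = - w"
definition reflS :: "complex \<Rightarrow> complex" where "reflS w = cnj w"
definition reflRS :: "complex \<Rightarrow> complex" where "reflRS w = rotR (reflS w)"

definition D2 :: "(complex \<Rightarrow> complex) set" where
  "D2 = {id, rotR, reflS, reflRS}"

definition C2_curve :: "(real \<Rightarrow> complex) \<Rightarrow> bool" where
  "C2_curve \<gamma> \<longleftrightarrow> (\<exists>g1 g2. (\<forall>t. (\<gamma> has_vector_derivative g1 t) (at t))
      \<and> (\<forall>t. (g1 has_vector_derivative g2 t) (at t)) \<and> continuous_on UNIV g2)"

definition vel :: "(real \<Rightarrow> complex) \<Rightarrow> real \<Rightarrow> complex" where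
  "vel \<gamma> t = vector_derivative \<gamma> (at t)"

definition acc :: "(real \<Rightarrow> complex) \<Rightarrow> real \<Rightarrow> complex" where
  "acc \<gamma> t = vector_derivative (vel \<gamma>) (at t)"

definition curv :: "(real \<Rightarrow> complex) \<Rightarrow> real \<Rightarrow> real" where
  "curv \<gamma> t = Im (cnj (vel \<gamma> t) * acc \<gamma> t) / (cmod (vel \<gamma> t)) ^ 3"

definition curv_at :: "(real \<Rightarrow> complex) \<Rightarrow> complex \<Rightarrow> real" where
  "curv_at \<gamma> z = curv \<gamma> (SOME t. \<gamma> t = z)"

definition strictly_convex_set :: "complex set \<Rightarrow> bool" where
  "strictly_convex_set K \<longleftrightarrow> convex K \<and>
     (\<forall>x\<in>K. \<forall>y\<in>K. x \<noteq> y \<longrightarrow> open_segment x y \<subseteq> interior K)"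

definition billiard_curve :: "(real \<Rightarrow> complex) \<Rightarrow> bool" where
  "billiard_curve \<gamma> \<longleftrightarrow> C2_curve \<gamma>
     \<and> (\<forall>s t. \<gamma> s = \<gamma> t \<longleftrightarrow> s - t \<in> \<int>)
     \<and> (\<forall>t. vel \<gamma> t \<noteq> 0)
     \<and> (\<exists>K. compact K \<and> strictly_convex_set K \<and> interior K \<noteq> {}
           \<and> frontier K = range \<gamma>
           \<and> (\<forall>w\<in>interior K. winding_number \<gamma> w = 1))"

definition equivariant :: "(real \<Rightarrow> complex) \<Rightarrow> bool" where
  "equivariant \<gamma> \<longleftrightarrow> (\<forall>x. \<gamma> (x + 1/2) = rotR (\<gamma> x) \<and> \<gamma> (- x) = reflS (\<gamma> x))"

definition billiard_seq :: "(real \<Rightarrow> complex) \<Rightarrow> (int \<Rightarrow> complex) \<Rightarrow> bool" where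
  "billiard_seq \<gamma> z \<longleftrightarrow> (\<forall>i. z i \<in> range \<gamma> \<and> z i \<noteq> z (i + 1))"

text \<open>Reflection law at z_i: the outgoing unit direction is the mirror image of the
  incoming unit direction in the tangent line (w \<mapsto> T^2 cnj w for a unit tangent T).\<close>
definition billiard_orbit :: "(real \<Rightarrow> complex) \<Rightarrow> (int \<Rightarrow> complex) \<Rightarrow> bool" where
  "billiard_orbit \<gamma> z \<longleftrightarrow> billiard_seq \<gamma> z \<and>
     (\<forall>i. \<exists>t. \<gamma> t = z i \<and>
        sgn (z (i + 1) - z i) = (sgn (vel \<gamma> t))\<^sup>2 * cnj (sgn (z i - z (i - 1))))"

definition is_lift :: "(real \<Rightarrow> complex) \<Rightarrow> (int \<Rightarrow> complex) \<Rightarrow> (int \<Rightarrow> real) \<Rightarrow> bool" where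
  "is_lift \<gamma> z x \<longleftrightarrow> (\<forall>i. \<gamma> (x i) = z i \<and> 0 < x (i + 1) - x i \<and> x (i + 1) - x i < 1)"

definition Xpq :: "int \<Rightarrow> int \<Rightarrow> (int \<Rightarrow> real) set" where
  "Xpq p q = {x. \<forall>i. x (i + p) = x i + of_int q}"

definition birkhoff :: "(int \<Rightarrow> real) \<Rightarrow> bool" where
  "birkhoff x \<longleftrightarrow> (\<forall>i j m l :: int.
      x i \<le> x j + of_int l \<longrightarrow> x (i + m) \<le> x (j + m) + of_int l)"

definition birkhoff_seq :: "(real \<Rightarrow> complex) \<Rightarrow> (int \<Rightarrow> complex) \<Rightarrow> bool" where
  "birkhoff_seq \<gamma> z \<longleftrightarrow> (\<exists>x. is_lift \<gamma> z x \<and> birkhoff x)"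

definition periodic_seq :: "(int \<Rightarrow> complex) \<Rightarrow> int \<Rightarrow> bool" where
  "periodic_seq z p \<longleftrightarrow> (\<forall>i. z (i + p) = z i)"

definition minimal_period :: "(int \<Rightarrow> complex) \<Rightarrow> int \<Rightarrow> bool" where
  "minimal_period z p \<longleftrightarrow> 0 < p \<and> periodic_seq z p \<and>
     (\<forall>q. 0 < q \<and> q < p \<longrightarrow> \<not> periodic_seq z q)"

definition rotation_number :: "(real \<Rightarrow> complex) \<Rightarrow> (int \<Rightarrow> complex) \<Rightarrow> real \<Rightarrow> bool" where
  "rotation_number \<gamma> z \<rho> \<longleftrightarrow>
     (\<exists>x. is_lift \<gamma> z x \<and> (\<lambda>n. x (int n) / real n) \<longlonglongrightarrow> \<rho>)"

definition symH :: "(int \<Rightarrow> complex) \<Rightarrow> (complex \<Rightarrow> complex) set" where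
  "symH z = {h \<in> D2. \<exists>k. (\<forall>i. h (z i) = z (k + i)) \<or> (\<forall>i. h (z i) = z (k - i))}"

text \<open>Number of (cyclic) sign changes per period p of a p-periodic real sequence:
  zero entries are skipped; we count indices i in [0,p) with d i \<noteq> 0 whose next
  nonzero entry has opposite sign.\<close>
definition sign_changes :: "(int \<Rightarrow> real) \<Rightarrow> int \<Rightarrow> nat" where
  "sign_changes d p = card {i \<in> {0..<p}. d i \<noteq> 0 \<and>
      (\<exists>j>i. d i * d j < 0 \<and> (\<forall>m. i < m \<and> m < j \<longrightarrow> d m = 0))}"

end

theory Submission
  imports Defs
begin

text \<open>
  Choose \<open>\<gamma> t\<^sub>0 = Z 0\<close> and rotate the plane so that \<open>Z 0\<close> lies on the positive real axis. Then
  \<open>g t = \<omega> * \<gamma> (t\<^sub>0 + t)\<close> satisfies \<open>g (- t) = cnj (g t)\<close> and \<open>g (t + 1/2) = - g t\<close>, and in terms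
  of the displacements \<open>d i = x i - X i\<close> the distance between consecutive impact points is
  \<open>\<bar>g (d i) + g (d (i + 1))\<bar>\<close>. Restrict the length to \<open>2 s\<close>-periodic displacements with
  \<open>d (- i) = d i\<close>, \<open>d (s - i) = - d i\<close> and \<open>0 \<le> d i \<le> 1/4\<close> for \<open>2 i \<le> s\<close>, and maximise it. On the
  faces of this box the partial derivatives point inwards, strictly unless all relevant neighbours lie on the
  same face, so a maximum is either \<open>d = 0\<close> or interior. The curvature condition says that the
  second variation at \<open>d = 0\<close> in the direction \<open>cos (i \<pi> / s)\<close> is positive, so the maximum is
  interior; it is a critical point, hence a billiard orbit, and the sign pattern of \<open>d\<close> yields all the
  other claims.
\<close>

section \<open>Maxima over a box\<close>

text \<open>The constant in the curvature condition comes from the test direction: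
  \<open>u i = cos (i * pi / s)\<close> has the required symmetries and satisfies u (i-1) + u (i+1)
  = 2 cos (pi/s) u i. Hence the second variation, a sum over edges of A (a^2 + b^2) + B (a + b)^2,
  collapses to A + B (1 + cos (pi/s)) times a sum of squares. That factor is positive exactly when
  \<kappa>L < 1 + cos (pi/s) = 2 cos^2 (pi/p). The obstacle is that two corners of the box annul the
  derivatives of all inner edges: \<open>d = 0\<close>, which is \<open>Z\<close> itself, and
  \<open>d = 1/4\<close> throughout. The first is beaten by the test direction; the second fails at
  the last edge, which antisymmetry pulls back towards 0. A critical point among symmetric chains is
  critical among all chains, since the gradient inherits the symmetries. The Birkhoff property would
  give d (i+2) - d i the same sign for all i; by periodicity these differences would vanish, which
  the sign pattern of \<open>d\<close> forbids.\<close>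

text \<open>Tychonoff: the box is a product of compact intervals. All coordinates are bounded,
  although the functional to be maximised sees only finitely many.\<close>

lemma compact_function_box:
  fixes a b :: real
  shows "compact {d :: nat \<Rightarrow> real. \<forall>i. d i \<in> {a..b}}"
proof -
  have "{d :: nat \<Rightarrow> real. \<forall>i. d i \<in> {a..b}} = PiE UNIV (\<lambda>_. {a..b})"
    by (auto simp: PiE_def Pi_def)
  moreover have "compactin (product_topology (\<lambda>_. euclidean) UNIV) (PiE (UNIV::nat set) (\<lambda>_. {a..b}))"
    by (subst compactin_PiE) auto
  ultimately show ?thesis
    by (simp add: euclidean_product_topology)
qed

text \<open>At a maximum, a coordinate on a face has a partial derivative that does not point
  inwards, while the face conditions make each of its summands point inwards or vanish. So all
  summands vanish and the neighbours lie on the same face: contact with a face spreads along the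
  chain.\<close>

lemma box_maximum_interior:
  fixes f D :: "real \<Rightarrow> real \<Rightarrow> real" and E E' :: "real \<Rightarrow> real" and n :: nat and r :: real
  defines "F \<equiv> \<lambda>d :: nat \<Rightarrow> real. (\<Sum>i<n-1. f (d i) (d (Suc i))) + E (d (n-1))"
  assumes r: "0 < r" and n: "0 < n"
    and f_sym: "\<And>a b. f a b = f b a"
    and f_cont: "continuous_on UNIV (\<lambda>p. f (fst p) (snd p))"
    and E_cont: "continuous_on UNIV E"
    and f_deriv: "\<And>a b. a \<in> {0..r} \<Longrightarrow> b \<in> {0..r} \<Longrightarrow> (f a has_real_derivative D a b) (at b)"
    and E_deriv: "\<And>b. b \<in> {0..r} \<Longrightarrow> (E has_real_derivative E' b) (at b)"
    and D_0: "\<And>a. a \<in> {0<..r} \<Longrightarrow> D a 0 > 0" "D 0 0 = 0"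
    and D_r: "\<And>a. a \<in> {0..<r} \<Longrightarrow> D a r < 0" "D r r = 0"
    and E_0: "E' 0 = 0" and E_r: "E' r < 0"
    and b: "\<And>i. b i \<in> {0..r}" "F b > F (\<lambda>_. 0)"
  shows "\<exists>d. (\<forall>k<n. 0 < d k \<and> d k < r) \<and>
    (\<forall>k<n. (if k = 0 then 0 else D (d (k-1)) (d k)) +
      (if Suc k < n then D (d (Suc k)) (d k) else E' (d k)) = 0)"
proof -
  let ?K = "{d :: nat \<Rightarrow> real. \<forall>i. d i \<in> {0..r}}"
  have cont_coord: "continuous_on UNIV (\<lambda>d :: nat \<Rightarrow> real. d i)" for i
    by (rule continuous_on_product_coordinates)
  have "continuous_on UNIV F"
    unfolding F_def
    by (intro continuous_intros continuous_on_compose2[OF E_cont] cont_coord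
        continuous_on_compose2[OF f_cont, of _ "\<lambda>d. (d _, d _)", simplified]) auto
  then have "continuous_on ?K F"
    using continuous_on_subset by blast
  moreover have "?K \<noteq> {}"
    using b by blast
  ultimately obtain d where dK: "d \<in> ?K" and max: "\<And>e. e \<in> ?K \<Longrightarrow> F e \<le> F d"
    using continuous_attains_sup[OF compact_function_box, of 0 r F] by blast
  have dr: "d i \<in> {0..r}" for i
    using dK by auto
  define grad where "grad k = (if k = 0 then 0 else D (d (k-1)) (d k)) +
      (if Suc k < n then D (d (Suc k)) (d k) else E' (d k))" for k
  \<comment> \<open>Coordinate \<open>k\<close> occurs in at most two edges; \<open>f_sym\<close>
    lets both be differentiated in the second argument, so that the single function \<open>D\<close>
    suffices.\<close>
  have deriv: "((\<lambda>y. F (d(k := y))) has_real_derivative grad k) (at (d k))" if k: "k < n" for k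
  proof -
    have t: "((\<lambda>y. f ((d(k:=y)) i) ((d(k:=y)) (Suc i))) has_real_derivative
        (if i = k then D (d (Suc k)) (d k) else 0) + (if Suc i = k then D (d (k-1)) (d k) else 0)) (at (d k))"
      for i
    proof -
      consider "i = k" | "Suc i = k" | "i \<noteq> k" "Suc i \<noteq> k" by blast
      then show ?thesis
      proof cases
        case 1
        then have "(\<lambda>y. f ((d(k:=y)) i) ((d(k:=y)) (Suc i))) = f (d (Suc k))"
          by (auto simp: f_sym)
        with 1 show ?thesis using f_deriv[OF dr dr, of "Suc k" k] by simp
      next
        case 2
        then have "(\<lambda>y. f ((d(k:=y)) i) ((d(k:=y)) (Suc i))) = f (d (k-1))"
          by auto
        with 2 show ?thesis using f_deriv[OF dr dr, of "k-1" k] by auto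
      next
        case 3
        then show ?thesis by simp
      qed
    qed
    have e: "((\<lambda>y. E ((d(k:=y)) (n-1))) has_real_derivative (if Suc k < n then 0 else E' (d k))) (at (d k))"
    proof (cases "Suc k < n")
      case False
      with k have "n - 1 = k" by auto
      with False show ?thesis using E_deriv[OF dr] by simp
    next
      case True
      then have "n - 1 \<noteq> k" by auto
      with True show ?thesis by simp
    qed
    have "((\<lambda>y. F (d(k := y))) has_real_derivative
       (\<Sum>i<n-1. (if i = k then D (d (Suc k)) (d k) else 0) + (if Suc i = k then D (d (k-1)) (d k) else 0))
         + (if Suc k < n then 0 else E' (d k))) (at (d k))"
      unfolding F_def by (intro DERIV_add DERIV_sum t e)
    moreover have "(\<Sum>i<n-1. (if i = k then D (d (Suc k)) (d k) else 0)) = (if Suc k < n then D (d (Suc k)) (d k) else 0)"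
      using k by (simp add: sum.delta less_diff_conv)
    moreover have "(\<Sum>i<n-1. (if Suc i = k then D (d (k-1)) (d k) else 0)) = (if k = 0 then 0 else D (d (k-1)) (d k))"
    proof (cases k)
      case (Suc m)
      with k have "m < n - 1" by simp
      with Suc show ?thesis by (simp add: sum.delta)
    qed simp
    ultimately show ?thesis
      by (simp add: sum.distrib grad_def add_ac split: if_splits)
  qed
  have upd: "d(k := y) \<in> ?K" if "y \<in> {0..r}" for k y
    using dr that by auto
  have max': "F (d(k := y)) \<le> F (d(k := d k))" if "y \<in> {0..r}" for k y
    using max[OF upd[OF that]] by simp
  have grad_left: "grad k \<le> 0" if k: "k < n" and z: "d k < r" for k
  proof (rule ccontr)
    assume "\<not> grad k \<le> 0"
    then obtain e where e: "e > 0" "\<And>h. 0 < h \<Longrightarrow> h < e \<Longrightarrow> F (d(k := d k)) < F (d(k := d k + h))"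
      using DERIV_pos_inc_right[OF deriv[OF k]] by force
    define h where "h = min (e/2) (r - d k)"
    have "0 < h" "h < e" "d k + h \<in> {0..r}"
      using e(1) z dr[of k] by (auto simp: h_def)
    then show False using e(2)[of h] max'[of "d k + h" k] by force
  qed
  have grad_right: "grad k \<ge> 0" if k: "k < n" and z: "0 < d k" for k
  proof (rule ccontr)
    assume "\<not> grad k \<ge> 0"
    then obtain e where e: "e > 0" "\<And>h. 0 < h \<Longrightarrow> h < e \<Longrightarrow> F (d(k := d k)) < F (d(k := d k - h))"
      using DERIV_neg_dec_left[OF deriv[OF k]] by force
    define h where "h = min (e/2) (d k)"
    have "0 < h" "h < e" "d k - h \<in> {0..r}"
      using e(1) z dr[of k] by (auto simp: h_def)
    then show False using e(2)[of h] max'[of "d k - h" k] by force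
  qed
  have D0': "D (d i) 0 \<ge> 0" "D (d i) 0 = 0 \<Longrightarrow> d i = 0" for i
    using D_0(1)[of "d i"] D_0(2) dr[of i] by (cases "d i = 0"; fastforce)+
  have Dr': "D (d i) r \<le> 0" "D (d i) r = 0 \<Longrightarrow> d i = r" for i
    using D_r(1)[of "d i"] D_r(2) dr[of i] by (cases "d i = r"; fastforce)+
  \<comment> \<open>Maximality gives a nonpositive derivative at 0, but it is a sum of nonnegative
    terms.\<close>
  have zero_up: "d (Suc k) = 0" if "Suc k < n" "d k = 0" for k
  proof -
    have "grad k \<le> 0" using grad_left[of k] that r by simp
    then have "D (d (Suc k)) 0 = 0"
      using that D0'(1)[of "Suc k"] D0'(1)[of "k-1"] by (auto simp: grad_def split: if_splits)
    then show ?thesis by (rule D0')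
  qed
  have zero_down: "d k = 0" if "Suc k < n" "d (Suc k) = 0" for k
  proof -
    have "grad (Suc k) \<le> 0" using grad_left[of "Suc k"] that r by simp
    then have "D (d k) 0 = 0"
      using that D0'(1)[of "Suc (Suc k)"] D0'(1)[of k] E_0 by (auto simp: grad_def split: if_splits)
    then show ?thesis by (rule D0')
  qed
  have pos: "0 < d k" if k: "k < n" for k
  proof (rule ccontr)
    assume "\<not> 0 < d k"
    then have dk: "d k = 0" using dr[of k] by auto
    have d_0: "d 0 = 0"
      using k dk by (induction k) (auto intro: zero_down)
    have all: "d i = 0" if "i < n" for i
      using that d_0 by (induction i) (auto intro: zero_up)
    have "F d = F (\<lambda>_. 0)"
      using all n by (simp add: F_def)
    then show False using max[of b] b by auto
  qed
  \<comment> \<open>On the upper face contact is propagated only towards the last index, where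
    \<open>E' r < 0\<close> already contradicts it.\<close>
  have up: "d k < r" if k: "k < n" for k
  proof (rule ccontr)
    assume "\<not> d k < r"
    then have dk: "d k = r" using dr[of k] by auto
    have g: "grad i \<ge> 0" if "i < n" "d i = r" for i
      using grad_right[of i] that r by simp
    have r_up: "d (Suc i) = r" if "Suc i < n" "d i = r" for i
    proof -
      have "D (d (Suc i)) r = 0"
        using g[of i] that Dr'(1)[of "Suc i"] Dr'(1)[of "i-1"] by (auto simp: grad_def split: if_splits)
      then show ?thesis by (rule Dr')
    qed
    \<comment> \<open>Induction on the distance to the last index. Once \<open>Suc j\<close> reaches
      \<open>n\<close>, truncated subtraction makes both indices 0 and the step is trivial.\<close>
    have "d (n - 1 - j) = r \<longrightarrow> d (n-1) = r" for j
    proof (induction j)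
      case (Suc j)
      then show ?case using r_up[of "n - 1 - Suc j"] by (cases "Suc j < n") (auto simp: Suc_diff_Suc)
    qed simp
    from this[of "n - 1 - k"] have "d (n-1) = r"
      using k dk by simp
    with g[of "n-1"] n Dr'(1)[of "n-1-1"] E_r show False
      by (auto simp: grad_def split: if_splits)
  qed
  have "grad k = 0" if "k < n" for k
    using grad_left[OF that up] grad_right[OF that pos] that by force
  then show ?thesis
    using pos up by (intro exI[of _ d]) (auto simp: grad_def)
qed

section \<open>Chords of a symmetric oval\<close>

text \<open>The curve seen from an impact point of the 2-periodic orbit, placed on the positive real
  axis. Strict convexity and orientation survive only as the two half-plane conditions
  \<open>Re_pos\<close> and \<open>Im_pos\<close>. By \<open>g_half\<close>,
  \<open>chord a b\<close> below is the distance from \<open>g a\<close> to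
  \<open>g (b + 1/2)\<close>.\<close>

locale symmetric_oval =
  fixes g g1 g2 :: "real \<Rightarrow> complex"
  assumes g_deriv: "(g has_vector_derivative g1 t) (at t)"
    and g1_deriv: "(g1 has_vector_derivative g2 t) (at t)"
    and regular: "g1 t \<noteq> 0"
    and g_eqD: "g a = g b \<Longrightarrow> a - b \<in> \<int>"
    and g_minus: "g (- t) = cnj (g t)"
    and g_half: "g (t + 1/2) = - g t"
    and Re_pos: "\<bar>t\<bar> < 1/4 \<Longrightarrow> 0 < Re (g t)"
    and Im_pos: "0 < t \<Longrightarrow> t < 1/2 \<Longrightarrow> 0 < Im (g t)"
begin

abbreviation chord :: "real \<Rightarrow> real \<Rightarrow> real" where
  "chord a b \<equiv> cmod (g a + g b)"

text \<open>The partial derivative of \<open>chord\<close> in its second argument, wherever the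
  chord does not vanish; it is the tangential component of a unit direction, scaled by the
  speed.\<close>

definition chord' :: "real \<Rightarrow> real \<Rightarrow> real" where
  "chord' a b = g1 b \<bullet> sgn (g a + g b)"

lemma Re_deriv: "((\<lambda>t. Re (g t)) has_real_derivative Re (g1 t)) (at t)"
  and Im_deriv: "((\<lambda>t. Im (g t)) has_real_derivative Im (g1 t)) (at t)"
  and Re_deriv2: "((\<lambda>t. Re (g1 t)) has_real_derivative Re (g2 t)) (at t)"
  using g_deriv g1_deriv by (auto intro: has_field_derivative_Re has_field_derivative_Im)

lemma g_cont: "continuous_on A g"
  using g_deriv continuous_at_imp_continuous_on has_vector_derivative_continuous by blast

lemma g1_minus: "g1 (- t) = - cnj (g1 t)"
proof -
  have "((\<lambda>t. g (- t)) has_vector_derivative - g1 (- t)) (at t)"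
    using vector_diff_chain_at[OF has_vector_derivative_minus[OF has_vector_derivative_id] g_deriv, of t]
    by (simp add: o_def)
  moreover have "((\<lambda>t. g (- t)) has_vector_derivative cnj (g1 t)) (at t)"
    unfolding g_minus by (intro has_vector_derivative_cnj g_deriv)
  ultimately have "- g1 (- t) = cnj (g1 t)"
    by (rule vector_derivative_unique_at)
  then show ?thesis by (metis minus_minus)
qed

lemma g1_half: "g1 (t + 1/2) = - g1 t"
proof -
  have "((\<lambda>t. g (t + 1/2)) has_vector_derivative g1 (t + 1/2)) (at t)"
    using vector_diff_chain_at[of "\<lambda>t. t + 1/2" 1 t g, OF _ g_deriv]
    by (simp add: o_def has_vector_derivative_add_const)
  moreover have "((\<lambda>t. g (t + 1/2)) has_vector_derivative - g1 t) (at t)"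
    unfolding g_half by (intro has_vector_derivative_minus g_deriv)
  ultimately show ?thesis
    by (rule vector_derivative_unique_at)
qed

lemma Im_g_0: "Im (g 0) = 0"
  using g_minus[of 0] by (metis Reals_cnj_iff complex_is_Real_iff minus_zero)

lemma Re_g1_0: "Re (g1 0) = 0"
  using arg_cong[OF g1_minus[of 0], of Re] by simp

lemma Re_g_quarter: "Re (g (1/4)) = 0"
  using arg_cong[OF g_half[of "-1/4"], of Re] g_minus[of "1/4"] by simp

lemma Im_g1_quarter: "Im (g1 (1/4)) = 0"
  using arg_cong[OF g1_half[of "-1/4"], of Im] g1_minus[of "1/4"] by simp

lemma Re_g_0: "0 < Re (g 0)"
  using Re_pos[of 0] by simp

lemma Re_nonneg: "\<bar>t\<bar> \<le> 1/4 \<Longrightarrow> 0 \<le> Re (g t)"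
proof (cases "\<bar>t\<bar> = 1/4")
  case True
  then have "t = 1/4 \<or> t = - (1/4)" by linarith
  moreover have "Re (g (- (1/4))) = 0"
    by (simp only: g_minus Re_g_quarter cnj.sel)
  ultimately show ?thesis
    using Re_g_quarter by (metis order_refl)
qed (use Re_pos[of t] in auto)

text \<open>The mirror symmetry makes this tangent vertical and regularity makes it nonzero;
  pointing down, it would push the curve below the axis just after 0, against
  \<open>Im_pos\<close>.\<close>

lemma Im_g1_0: "0 < Im (g1 0)"
proof -
  have "Im (g1 0) \<noteq> 0"
    using regular[of 0] Re_g1_0 by (simp add: complex_eq_iff)
  moreover have "\<not> Im (g1 0) < 0"
  proof
    assume "Im (g1 0) < 0"
    from DERIV_neg_dec_right[OF Im_deriv this]
    obtain e where e: "0 < e" "\<And>h. 0 < h \<Longrightarrow> h < e \<Longrightarrow> Im (g h) < Im (g 0)" by auto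
    have "Im (g (min (e/2) (1/4))) < 0"
      using e Im_g_0 by simp
    moreover have "Im (g (min (e/2) (1/4))) > 0"
      using e by (intro Im_pos) auto
    ultimately show False by simp
  qed
  ultimately show ?thesis by simp
qed

lemma Re_g1_quarter: "Re (g1 (1/4)) < 0"
proof -
  have "Re (g1 (1/4)) \<noteq> 0"
    using regular[of "1/4"] Im_g1_quarter by (simp add: complex_eq_iff)
  moreover have "\<not> Re (g1 (1/4)) > 0"
  proof
    assume "Re (g1 (1/4)) > 0"
    from DERIV_pos_inc_left[OF Re_deriv this]
    obtain e where e: "0 < e" "\<And>h. 0 < h \<Longrightarrow> h < e \<Longrightarrow> Re (g (1/4 - h)) < Re (g (1/4))" by auto
    have "Re (g (1/4 - min (e/2) (1/8))) < 0"
      using e Re_g_quarter by simp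
    moreover have "Re (g (1/4 - min (e/2) (1/8))) > 0"
      using e by (intro Re_pos) auto
    ultimately show False by simp
  qed
  ultimately show ?thesis by simp
qed

text \<open>Both points have nonnegative real part, which vanishes only at parameter 1/4, and there
  the imaginary part is positive.\<close>

lemma g_add_nonzero:
  assumes "a \<in> {0..1/4}" "b \<in> {0..1/4}"
  shows "g a + g b \<noteq> 0"
proof (cases "a = 1/4 \<and> b = 1/4")
  case True
  then have "0 < Im (g a)" "0 < Im (g b)" by (auto intro: Im_pos)
  then have "0 < Im (g a + g b)" by simp
  then show ?thesis by force
next
  case False
  then have "0 < Re (g a) \<or> 0 < Re (g b)" using assms Re_pos[of a] Re_pos[of b] by auto
  moreover have "0 \<le> Re (g a)" "0 \<le> Re (g b)" using assms by (auto intro: Re_nonneg)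
  ultimately have "0 < Re (g a + g b)" by auto
  then show ?thesis by force
qed

lemma chord_deriv:
  assumes "g a + g b \<noteq> 0"
  shows "(chord a has_real_derivative chord' a b) (at b)"
proof -
  have "((\<lambda>y. g a + g y) has_derivative (\<lambda>h. h *\<^sub>R g1 b)) (at b)"
    using g_deriv[of b] unfolding has_vector_derivative_def by (auto intro!: derivative_eq_intros)
  from has_derivative_compose[OF this has_derivative_norm[OF assms]]
  have "(chord a has_derivative (\<lambda>h. h *\<^sub>R g1 b \<bullet> sgn (g a + g b))) (at b)" .
  moreover have "(\<lambda>h. h *\<^sub>R g1 b \<bullet> sgn (g a + g b)) = (*) (chord' a b)"
    by (auto simp: chord'_def)
  ultimately show ?thesis
    by (simp only: has_field_derivative_def)
qed

lemma chord'_eq: "chord' a b = (Re (g1 b) * Re (g a + g b) + Im (g1 b) * Im (g a + g b)) / cmod (g a + g b)"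
  by (simp add: chord'_def sgn_div_norm inner_complex_def field_simps add_divide_distrib)

text \<open>This and the next three facts are the face conditions of
  \<open>box_maximum_interior\<close>. At parameter 0 the tangent points straight up, so only the
  height of \<open>g a\<close> counts; at 1/4 it points straight left, so only the real part
  counts.\<close>

lemma chord'_0_pos: "a \<in> {0<..1/4} \<Longrightarrow> 0 < chord' a 0"
  using Im_pos[of a] Im_g1_0 g_add_nonzero[of a 0]
  by (auto simp: chord'_eq Re_g1_0 Im_g_0 intro!: divide_pos_pos)

lemma chord'_0_0: "chord' 0 0 = 0"
  by (simp add: chord'_eq Re_g1_0 Im_g_0)

lemma chord'_quarter_neg: "a \<in> {0..<1/4} \<Longrightarrow> chord' a (1/4) < 0"
  using Re_pos[of a] Re_g1_quarter g_add_nonzero[of a "1/4"]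
  by (auto simp: chord'_eq Im_g1_quarter Re_g_quarter intro!: divide_neg_pos mult_neg_pos)

lemma chord'_quarter: "chord' (1/4) (1/4) = 0"
  by (simp add: chord'_eq Im_g1_quarter Re_g_quarter)

lemma chord'_minus: "chord' (- a) (- b) = - chord' a b"
proof -
  have "cmod (cnj (g a) + cnj (g b)) = chord a b"
    by (metis complex_cnj_add complex_mod_cnj)
  then have "chord' (- a) (- b) =
      (- (Re (g1 b) * Re (g a + g b) + Im (g1 b) * Im (g a + g b))) / chord a b"
    by (simp add: chord'_eq g_minus g1_minus algebra_simps)
  then show ?thesis
    by (simp only: chord'_eq minus_divide_left)
qed

text \<open>\<open>g b\<close> and \<open>g (- b)\<close> are conjugate with positive real part, so
  the unit direction is 1. This identifies the derivative of the odd end term with that of an actual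
  edge.\<close>

lemma chord'_antipodal:
  assumes "\<bar>b\<bar> < 1/4"
  shows "chord' (- b) b = Re (g1 b)"
  using Re_pos[OF assms] by (simp add: chord'_eq g_minus complex_add_cnj add.commute)

text \<open>The linear term is absent because the tangent at 0 is vertical. One use of l'Hopital
  leaves the difference quotient of \<open>Re (g1 t)\<close> at 0, so its limit is the second
  derivative there by definition.\<close>

lemma quadratic_expansion:
  obtains \<psi> where "\<And>t. Re (g t) = Re (g 0) + t\<^sup>2 * \<psi> t" "isCont \<psi> 0" "\<psi> 0 = Re (g2 0) / 2"
proof
  let ?\<psi> = "\<lambda>t. if t = 0 then Re (g2 0) / 2 else (Re (g t) - Re (g 0)) / t\<^sup>2"
  show "Re (g t) = Re (g 0) + t\<^sup>2 * ?\<psi> t" for t by simp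
  show "?\<psi> 0 = Re (g2 0) / 2" by simp
  have "((\<lambda>t. (Re (g t) - Re (g 0)) / t\<^sup>2) \<longlongrightarrow> Re (g2 0) / 2) (at 0)"
  proof (rule lhopital)
    show "((\<lambda>t. Re (g t) - Re (g 0)) \<longlongrightarrow> 0) (at 0)"
      using DERIV_isCont[OF Re_deriv, of 0] by (simp add: isCont_def LIM_zero)
    show "((\<lambda>t::real. t\<^sup>2) \<longlongrightarrow> 0) (at 0)"
      by (auto intro!: tendsto_eq_intros)
    show "eventually (\<lambda>t::real. t\<^sup>2 \<noteq> 0) (at 0)" "eventually (\<lambda>t::real. 2 * t \<noteq> 0) (at 0)"
      by (auto simp: eventually_at_filter)
    show "eventually (\<lambda>t. DERIV (\<lambda>t. Re (g t) - Re (g 0)) t :> Re (g1 t)) (at 0)"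
      using DERIV_diff[OF Re_deriv DERIV_const] by simp
    show "eventually (\<lambda>t. DERIV (\<lambda>t::real. t\<^sup>2) t :> 2 * t) (at 0)"
      by (rule always_eventually) (auto intro!: derivative_eq_intros)
    have "((\<lambda>t. Re (g1 t) / t / 2) \<longlongrightarrow> Re (g2 0) / 2) (at 0)"
      using Re_deriv2[of 0] by (intro tendsto_intros) (auto simp: has_field_derivative_iff Re_g1_0)
    then show "((\<lambda>t. Re (g1 t) / (2 * t)) \<longlongrightarrow> Re (g2 0) / 2) (at 0)"
      by (simp add: field_simps)
  qed
  then have "(?\<psi> \<longlongrightarrow> Re (g2 0) / 2) (at 0)"
    by (rule Lim_transform_eventually) (auto simp: eventually_at_filter)
  then show "isCont ?\<psi> 0" by (simp add: isCont_def)
qed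

text \<open>The norm is not differentiated twice. For w = g (e a) + g (e b) one has |w| = Re w + (Im
  w)^2 / (|w| + Re w): the real part supplies the quadratic expansions, the imaginary part is of
  first order in e, and the denominator tends to 4 Re (g 0).\<close>

lemma chord_second_variation:
  "((\<lambda>e. (chord (e * a) (e * b) - chord 0 0) / e\<^sup>2) \<longlongrightarrow>
     Re (g2 0) / 2 * (a\<^sup>2 + b\<^sup>2) + (Im (g1 0))\<^sup>2 / (4 * Re (g 0)) * (a + b)\<^sup>2) (at_right 0)"
proof -
  obtain \<psi> where \<psi>: "\<And>t. Re (g t) = Re (g 0) + t\<^sup>2 * \<psi> t" "isCont \<psi> 0" "\<psi> 0 = Re (g2 0) / 2"
    using quadratic_expansion by blast
  obtain \<phi> where \<phi>: "\<And>t. Im (g t) = t * \<phi> t" "isCont \<phi> 0" "\<phi> 0 = Im (g1 0)"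
    using Im_deriv[of 0] Im_g_0 by (auto simp: CARAT_DERIV mult.commute)
  have lin: "((\<lambda>e. e * c) \<longlongrightarrow> 0) (at_right 0)" for c :: real
    by (auto intro!: tendsto_eq_intros)
  have \<psi>l: "((\<lambda>e. \<psi> (e * c)) \<longlongrightarrow> Re (g2 0) / 2) (at_right 0)" for c
    using isCont_tendsto_compose[OF \<psi>(2) lin] \<psi>(3) by simp
  have \<phi>l: "((\<lambda>e. \<phi> (e * c)) \<longlongrightarrow> Im (g1 0)) (at_right 0)" for c
    using isCont_tendsto_compose[OF \<phi>(2) lin] \<phi>(3) by simp
  have gl: "((\<lambda>e. g (e * c)) \<longlongrightarrow> g 0) (at_right 0)" for c
    using g_cont[of UNIV] by (intro isCont_tendsto_compose[OF _ lin]) (simp add: continuous_on_eq_continuous_at)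
  define w where "w e = g (e * a) + g (e * b)" for e
  have wl: "(w \<longlongrightarrow> g 0 + g 0) (at_right 0)"
    unfolding w_def by (intro tendsto_intros gl)
  have g0: "g 0 = of_real (Re (g 0))" by (simp add: complex_eq_iff Im_g_0)
  have c0: "cmod (g 0) = Re (g 0)"
    using Re_g_0 by (metis g0 norm_of_real abs_of_pos)
  have den: "((\<lambda>e. cmod (w e) + Re (w e)) \<longlongrightarrow> 2 * Re (g 0) + (Re (g 0) + Re (g 0))) (at_right 0)"
    using tendsto_add[OF tendsto_norm[OF wl] tendsto_Re[OF wl]] by (simp add: c0)
  have "((\<lambda>e. a\<^sup>2 * \<psi> (e * a) + b\<^sup>2 * \<psi> (e * b) + (a * \<phi> (e * a) + b * \<phi> (e * b))\<^sup>2 / (cmod (w e) + Re (w e))) \<longlongrightarrow>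
      a\<^sup>2 * (Re (g2 0) / 2) + b\<^sup>2 * (Re (g2 0) / 2) +
      (a * Im (g1 0) + b * Im (g1 0))\<^sup>2 / (2 * Re (g 0) + (Re (g 0) + Re (g 0)))) (at_right 0)"
    using Re_g_0 by (intro tendsto_intros \<psi>l \<phi>l den) simp
  moreover have "a\<^sup>2 * (Re (g2 0) / 2) + b\<^sup>2 * (Re (g2 0) / 2) +
      (a * Im (g1 0) + b * Im (g1 0))\<^sup>2 / (2 * Re (g 0) + (Re (g 0) + Re (g 0))) =
      Re (g2 0) / 2 * (a\<^sup>2 + b\<^sup>2) + (Im (g1 0))\<^sup>2 / (4 * Re (g 0)) * (a + b)\<^sup>2"
    using Re_g_0 by (simp add: field_simps power2_eq_square)
  ultimately have lim: "((\<lambda>e. a\<^sup>2 * \<psi> (e * a) + b\<^sup>2 * \<psi> (e * b) + (a * \<phi> (e * a) + b * \<phi> (e * b))\<^sup>2 / (cmod (w e) + Re (w e))) \<longlongrightarrow>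
      Re (g2 0) / 2 * (a\<^sup>2 + b\<^sup>2) + (Im (g1 0))\<^sup>2 / (4 * Re (g 0)) * (a + b)\<^sup>2) (at_right 0)"
    by simp
  have pos: "eventually (\<lambda>e. 0 < cmod (w e) + Re (w e)) (at_right 0)"
    using order_tendstoD(1)[OF den, of 0] Re_g_0 by simp
  have "eventually (\<lambda>e::real. 0 < e) (at_right 0)"
    by (rule eventually_at_right_less)
  with pos have "eventually (\<lambda>e. a\<^sup>2 * \<psi> (e * a) + b\<^sup>2 * \<psi> (e * b) + (a * \<phi> (e * a) + b * \<phi> (e * b))\<^sup>2 / (cmod (w e) + Re (w e))
      = (chord (e * a) (e * b) - chord 0 0) / e\<^sup>2) (at_right 0)"
  proof eventually_elim
    case (elim e)
    have Re_w: "Re (w e) = 2 * Re (g 0) + e\<^sup>2 * (a\<^sup>2 * \<psi> (e * a) + b\<^sup>2 * \<psi> (e * b))"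
      using \<psi>(1)[of "e * a"] \<psi>(1)[of "e * b"] by (simp add: w_def algebra_simps power2_eq_square)
    have Im_w: "Im (w e) = e * (a * \<phi> (e * a) + b * \<phi> (e * b))"
      using \<phi>(1)[of "e * a"] \<phi>(1)[of "e * b"] by (simp add: w_def algebra_simps)
    have "(cmod (w e) - Re (w e)) * (cmod (w e) + Re (w e)) = (Im (w e))\<^sup>2"
      using cmod_power2[of "w e"] by (simp add: algebra_simps power2_eq_square)
    then have "cmod (w e) - Re (w e) = (Im (w e))\<^sup>2 / (cmod (w e) + Re (w e))"
      using elim by (simp add: field_simps)
    then have "cmod (w e) - Re (w e) =
        e\<^sup>2 * ((a * \<phi> (e * a) + b * \<phi> (e * b))\<^sup>2 / (cmod (w e) + Re (w e)))"
      by (simp add: Im_w power_mult_distrib)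
    with Re_w have "cmod (w e) - 2 * Re (g 0) = e\<^sup>2 * (a\<^sup>2 * \<psi> (e * a) + b\<^sup>2 * \<psi> (e * b) +
        (a * \<phi> (e * a) + b * \<phi> (e * b))\<^sup>2 / (cmod (w e) + Re (w e)))"
      by (simp only: distrib_left)
    then show ?case using elim by (simp add: c0 flip: w_def)
  qed
  with lim show ?thesis by (rule Lim_transform_eventually)
qed

end

section \<open>Second variation of the length\<close>

text \<open>The eigenvector equation of the cosine in summed form: the product of neighbours is a
  multiple of their squares up to a telescoping difference.\<close>

lemma cos_multiples_telescope:
  fixes \<theta> :: real and i :: nat
  shows "2 * (cos (i * \<theta>) * cos (Suc i * \<theta>)) = cos \<theta> * ((cos (i * \<theta>))\<^sup>2 + (cos (Suc i * \<theta>))\<^sup>2)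
    + (sin \<theta> / 2 * sin (2 * (Suc i * \<theta>)) - sin \<theta> / 2 * sin (2 * (i * \<theta>)))"
proof -
  define x where "x = i * \<theta>"
  have S: "Suc i * \<theta> = x + \<theta>" by (simp add: x_def algebra_simps)
  have "2 * (cos x * cos (x + \<theta>)) = cos \<theta> * ((cos x)\<^sup>2 + (cos (x + \<theta>))\<^sup>2)
    + (sin \<theta> / 2 * (2 * sin (x + \<theta>) * cos (x + \<theta>)) - sin \<theta> / 2 * (2 * sin x * cos x))"
    unfolding cos_add sin_add using sin_cos_squared_add[of \<theta>] by algebra
  then show ?thesis unfolding S x_def[symmetric] sin_double .
qed

context symmetric_oval
begin

definition end_term :: "nat \<Rightarrow> real \<Rightarrow> real" where
  "end_term s y = (if even s then chord 0 y else Re (g y))"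

definition end_term' :: "nat \<Rightarrow> real \<Rightarrow> real" where
  "end_term' s y = (if even s then chord' 0 y else Re (g1 y))"

text \<open>Half the length, relative to one period, of the closed chain obtained by extending \<open>d\<close> with
  \<open>d (- i) = d i\<close> and \<open>d (s - i) = - d i\<close>. The last edge runs to \<open>0\<close> if \<open>s\<close> is even, and
  from \<open>y\<close> to \<open>- y\<close> (half of it counts) if \<open>s\<close> is odd; in the odd case \<open>Re (g y)\<close> replaces
  \<open>chord y (- y) / 2 = \<bar>Re (g y)\<bar>\<close>, which is not differentiable at \<open>1/4\<close>.\<close>
definition energy :: "nat \<Rightarrow> (nat \<Rightarrow> real) \<Rightarrow> real" where
  "energy s d = (\<Sum>i<(s+1) div 2 - 1. chord (d i) (d (Suc i))) + end_term s (d ((s+1) div 2 - 1))"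

text \<open>The end term is an ordinary edge from \<open>u (n-1)\<close> to \<open>u n\<close>, with
  weight 1 or 1/2: for even \<open>s\<close> the index \<open>n\<close> is the midpoint s/2, where
  the cosine vanishes; for odd \<open>s\<close> the midpoint lies halfway between
  \<open>n - 1\<close> and \<open>n\<close>, so the two values are opposite.\<close>

lemma end_term_second_variation:
  assumes "0 < s"
  defines "\<theta> \<equiv> pi / real s" and "n \<equiv> (s+1) div 2"
  defines "u \<equiv> \<lambda>i :: nat. cos (i * \<theta>)"
  shows "((\<lambda>e. (end_term s (e * u (n - 1)) - end_term s 0) / e\<^sup>2) \<longlongrightarrow>
     (if even s then 1 else 1/2) * (Re (g2 0) / 2 * ((u (n-1))\<^sup>2 + (u n)\<^sup>2)
       + (Im (g1 0))\<^sup>2 / (4 * Re (g 0)) * (u (n-1) + u n)\<^sup>2)) (at_right 0)"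
proof (cases "even s")
  case True
  then have "s = 2 * n" by (auto simp: n_def)
  then have "u n = 0" using assms(1) by (simp add: u_def \<theta>_def)
  with True show ?thesis
    using chord_second_variation[of 0 "u (n-1)"] by (simp add: end_term_def add.commute)
next
  case False
  then have s: "s + 1 = 2 * n" by (auto simp: n_def)
  have "n * \<theta> + (n - 1) * \<theta> = (real n + real (n - 1)) * \<theta>" by (simp add: algebra_simps)
  also have "real n + real (n - 1) = real s" using s assms(1) by linarith
  also have "real s * \<theta> = pi" using assms(1) by (simp add: \<theta>_def)
  finally have "n * \<theta> = pi - (n - 1) * \<theta>" by simp
  then have un: "u n = - u (n - 1)" by (simp add: u_def)
  have "((\<lambda>e. 1/2 * ((chord (e * u (n-1)) (e * u n) - chord 0 0) / e\<^sup>2)) \<longlongrightarrow>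
     1/2 * (Re (g2 0) / 2 * ((u (n-1))\<^sup>2 + (u n)\<^sup>2)
       + (Im (g1 0))\<^sup>2 / (4 * Re (g 0)) * (u (n-1) + u n)\<^sup>2)) (at_right 0)"
    by (intro tendsto_mult_left chord_second_variation)
  moreover have "eventually (\<lambda>e. 1/2 * ((chord (e * u (n-1)) (e * u n) - chord 0 0) / e\<^sup>2)
      = (end_term s (e * u (n - 1)) - end_term s 0) / e\<^sup>2) (at_right 0)"
  proof -
    \<comment> \<open>The odd end term agrees with half an edge only near 0, which is enough for a
      limit.\<close>
    have chord_antipodal: "chord y (- y) = 2 * Re (g y)" if "\<bar>y\<bar> < 1/4" for y
      using Re_pos[OF that] by (simp add: g_minus complex_add_cnj)
    have "((\<lambda>e. \<bar>e * u (n-1)\<bar>) \<longlongrightarrow> 0) (at_right 0)"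
      by (auto intro!: tendsto_eq_intros)
    then have "eventually (\<lambda>e. \<bar>e * u (n-1)\<bar> < 1/4) (at_right 0)"
      by (rule order_tendstoD) simp
    then show ?thesis
    proof eventually_elim
      case (elim e)
      show ?case
        using False chord_antipodal[OF elim] chord_antipodal[of 0]
        by (simp add: un end_term_def diff_divide_distrib)
    qed
  qed
  ultimately show ?thesis
    using False by (simp add: tendsto_cong)
qed

text \<open>The squares carry the factor \<open>K\<close>, positive by the curvature hypothesis; the
  telescoping remainder vanishes at both ends by the symmetry of the cosine.\<close>

lemma energy_second_variation_positive:
  assumes s: "2 \<le> s"
    and curv: "- Re (g2 0) / (Im (g1 0))\<^sup>2 * (2 * Re (g 0)) < 2 * (cos (pi / real (2 * s)))\<^sup>2"
  obtains q where "0 < q"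
    "((\<lambda>e. (energy s (\<lambda>i. e * cos (i * (pi / real s))) - energy s (\<lambda>_. 0)) / e\<^sup>2) \<longlongrightarrow> q) (at_right 0)"
proof
  define \<theta> where "\<theta> = pi / real s"
  define n where "n = (s+1) div 2"
  define u where "u i = cos (real i * \<theta>)" for i :: nat
  define B where "B = (Im (g1 0))\<^sup>2 / (4 * Re (g 0))"
  \<comment> \<open>With the curvature written as \<open>- Re (g2 0) / (Im (g1 0))\<^sup>2\<close>
    and L = 2 Re (g 0), the hypothesis is equivalent to K > 0.\<close>
  define K where "K = Re (g2 0) / 2 + B * (1 + cos \<theta>)"
  define Q where "Q i = Re (g2 0) / 2 * ((u i)\<^sup>2 + (u (Suc i))\<^sup>2) + B * (u i + u (Suc i))\<^sup>2" for i
  define T where "T i = sin \<theta> / 2 * sin (2 * (real i * \<theta>))" for i :: nat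
  define w :: real where "w = (if even s then 1 else 1/2)"
  have n: "0 < n" "Suc (n - 1) = n" using s by (auto simp: n_def)
  show "((\<lambda>e. (energy s (\<lambda>i. e * cos (i * (pi / real s))) - energy s (\<lambda>_. 0)) / e\<^sup>2) \<longlongrightarrow>
      (\<Sum>i<n-1. Q i) + w * Q (n-1)) (at_right 0)"
  proof -
    have "((\<lambda>e. (\<Sum>i<n-1. (chord (e * u i) (e * u (Suc i)) - chord 0 0) / e\<^sup>2)
        + (end_term s (e * u (n-1)) - end_term s 0) / e\<^sup>2) \<longlongrightarrow> (\<Sum>i<n-1. Q i) + w * Q (n-1)) (at_right 0)"
    proof (intro tendsto_add tendsto_sum)
      show "((\<lambda>e. (chord (e * u i) (e * u (Suc i)) - chord 0 0) / e\<^sup>2) \<longlongrightarrow> Q i) (at_right 0)" for i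
        unfolding Q_def B_def by (rule chord_second_variation)
      have "0 < s" using s by simp
      then show "((\<lambda>e. (end_term s (e * u (n-1)) - end_term s 0) / e\<^sup>2) \<longlongrightarrow> w * Q (n-1)) (at_right 0)"
        unfolding Q_def n(2) unfolding B_def w_def u_def \<theta>_def n_def
        by (rule end_term_second_variation)
    qed
    moreover have "(\<Sum>i<n-1. (chord (e * u i) (e * u (Suc i)) - chord 0 0) / e\<^sup>2)
        + (end_term s (e * u (n-1)) - end_term s 0) / e\<^sup>2 =
        (energy s (\<lambda>i. e * cos (i * (pi / real s))) - energy s (\<lambda>_. 0)) / e\<^sup>2" for e
      unfolding energy_def n_def[symmetric]
      by (simp add: u_def \<theta>_def sum_subtractf add_divide_distrib diff_divide_distrib
          flip: sum_divide_distrib)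
    ultimately show ?thesis by simp
  qed
  have "B > 0" using Im_g1_0 Re_g_0 by (simp add: B_def)
  have half: "1 + cos \<theta> = 2 * (cos (pi / real (2 * s)))\<^sup>2"
    using cos_double_cos[of "pi / real (2 * s)"] by (simp add: \<theta>_def field_simps)
  have "- Re (g2 0) * (2 * Re (g 0)) < (1 + cos \<theta>) * (Im (g1 0))\<^sup>2"
    using curv[folded half] Im_g1_0 by (simp only: times_divide_eq_left pos_divide_less_eq zero_less_power)
  then have "K > 0"
    using Re_g_0 by (simp add: K_def B_def field_simps)
  have Q: "Q i = K * ((u i)\<^sup>2 + (u (Suc i))\<^sup>2) + B * (T (Suc i) - T i)" for i
  proof -
    have "(u i + u (Suc i))\<^sup>2 = (1 + cos \<theta>) * ((u i)\<^sup>2 + (u (Suc i))\<^sup>2) + (T (Suc i) - T i)"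
      using cos_multiples_telescope[of i \<theta>]
      unfolding u_def T_def power2_sum by (simp only: distrib_right mult.assoc mult_1)
    then show ?thesis by (simp only: Q_def K_def distrib_left distrib_right add.assoc mult.assoc)
  qed
  \<comment> \<open>The sum contributes \<open>T (n-1) - T 0\<close> with \<open>T 0 = 0\<close>.
    For even \<open>s\<close> only \<open>T n\<close> is left, a multiple of sin pi; for odd
    \<open>s\<close> the mean of \<open>T n\<close> and \<open>T (n-1)\<close> is left, and these
    are opposite because their angles are pi + \<theta> and pi - \<theta>.\<close>
  have T: "T (n-1) + w * (T n - T (n-1)) = 0"
  proof (cases "even s")
    case True
    then have "2 * (n * \<theta>) = pi" using s by (auto simp: n_def \<theta>_def)
    with True show ?thesis by (simp add: w_def T_def)
  next
    case False
    then have "s + 1 = 2 * n" by (auto simp: n_def)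
    then have "2 * real n = real s + 1" "2 * real (n - 1) = real s - 1" using n by linarith+
    moreover have "real s * \<theta> = pi" using s by (simp add: \<theta>_def)
    ultimately have "2 * (n * \<theta>) = pi + \<theta>" "2 * (real (n - 1) * \<theta>) = pi - \<theta>"
      by (metis add_divide_distrib distrib_right mult.assoc mult_1, metis left_diff_distrib mult.assoc mult_1)
    then have "T n = sin \<theta> / 2 * sin (pi + \<theta>)" "T (n - 1) = sin \<theta> / 2 * sin (pi - \<theta>)"
      by (simp_all only: T_def)
    with False show ?thesis by (simp add: w_def field_simps)
  qed
  have "(\<Sum>i<n-1. Q i) + w * Q (n-1) = K * ((\<Sum>i<n-1. (u i)\<^sup>2 + (u (Suc i))\<^sup>2) + w * ((u (n-1))\<^sup>2 + (u n)\<^sup>2))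
      + B * ((\<Sum>i<n-1. T (Suc i) - T i) + w * (T n - T (n-1)))"
    unfolding Q n(2) sum.distrib by (simp add: distrib_left sum_distrib_left mult.left_commute sum.distrib)
  also have "(\<Sum>i<n-1. T (Suc i) - T i) = T (n-1)"
    by (subst sum_lessThan_telescope) (simp add: T_def)
  finally have eq: "(\<Sum>i<n-1. Q i) + w * Q (n-1) =
      K * ((\<Sum>i<n-1. (u i)\<^sup>2 + (u (Suc i))\<^sup>2) + w * ((u (n-1))\<^sup>2 + (u n)\<^sup>2))"
    by (simp only: T mult_zero_right add_0_right)
  have "real (n - 1) * \<theta> < pi / 2" 
  proof -
    have "real (n - 1) < real s / 2" using s by (simp add: n_def)
    then show ?thesis using s by (simp add: \<theta>_def field_simps)
  qed
  then have "0 < u (n - 1)"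
    unfolding u_def by (intro cos_gt_zero_pi) (auto simp: \<theta>_def intro: less_le_trans[of _ 0])
  then have "0 < w * ((u (n-1))\<^sup>2 + (u n)\<^sup>2)"
    by (auto simp: w_def add_pos_nonneg)
  moreover have "0 \<le> (\<Sum>i<n-1. (u i)\<^sup>2 + (u (Suc i))\<^sup>2)"
    by (intro sum_nonneg) auto
  ultimately show "0 < (\<Sum>i<n-1. Q i) + w * Q (n-1)"
    unfolding eq using \<open>K > 0\<close> by (intro mult_pos_pos) auto
qed

lemma energy_gain:
  assumes s: "2 \<le> s"
    and curv: "- Re (g2 0) / (Im (g1 0))\<^sup>2 * (2 * Re (g 0)) < 2 * (cos (pi / real (2 * s)))\<^sup>2"
  obtains d where "\<And>i. d i \<in> {0..1/4}" "energy s (\<lambda>_. 0) < energy s d"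
proof -
  define n where "n = (s+1) div 2"
  obtain q where q: "0 < q"
    "((\<lambda>e. (energy s (\<lambda>i. e * cos (i * (pi / real s))) - energy s (\<lambda>_. 0)) / e\<^sup>2) \<longlongrightarrow> q) (at_right 0)"
    using energy_second_variation_positive[OF assms] .
  have "eventually (\<lambda>e. 0 < (energy s (\<lambda>i. e * cos (i * (pi / real s))) - energy s (\<lambda>_. 0)) / e\<^sup>2) (at_right 0)"
    by (rule order_tendstoD(1)[OF q(2) q(1)])
  moreover have "eventually (\<lambda>e::real. 0 < e \<and> e < 1/4) (at_right 0)"
    by (auto simp: eventually_at_right_field intro!: exI[of _ "1/4"])
  ultimately have "eventually (\<lambda>e. 0 < (energy s (\<lambda>i. e * cos (i * (pi / real s))) - energy s (\<lambda>_. 0)) / e\<^sup>2 \<and> 0 < e \<and> e < 1/4) (at_right 0)"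
    by (rule eventually_conj)
  then obtain e where e: "0 < (energy s (\<lambda>i. e * cos (i * (pi / real s))) - energy s (\<lambda>_. 0)) / e\<^sup>2" "0 < e" "e < 1/4"
    using eventually_happens[of _ "at_right (0::real)"] by auto
  \<comment> \<open>Cut off beyond the half chain: \<open>energy\<close> does not see those entries,
    and the cosine could leave the box there. For i < n the angle is at most pi/2.\<close>
  define d where "d i = (if i < n then e * cos (i * (pi / real s)) else 0)" for i
  have "d i \<in> {0..1/4}" for i
  proof (cases "i < n")
    case True
    then have "real i \<le> real s / 2" by (simp add: n_def)
    then have "real i * (pi / real s) \<le> pi / 2" using s by (simp add: field_simps)
    then have "0 \<le> cos (real i * (pi / real s))"
      by (intro cos_ge_zero) (auto intro: order_trans[of _ 0])
    moreover have "e * cos (real i * (pi / real s)) \<le> 1/4"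
    proof -
      have "e * cos (real i * (pi / real s)) \<le> e * 1"
        using e by (intro mult_left_mono) auto
      then show ?thesis using e by linarith
    qed
    ultimately show ?thesis using e True by (simp add: d_def)
  qed (simp add: d_def)
  moreover have "energy s d = energy s (\<lambda>i. e * cos (i * (pi / real s)))"
  proof -
    have "0 < n" using s by (simp add: n_def)
    then show ?thesis unfolding energy_def n_def[symmetric]
      by (intro arg_cong2[where f = "(+)"] sum.cong) (auto simp: d_def)
  qed
  with e have "energy s (\<lambda>_. 0) < energy s d"
    by (simp add: zero_less_divide_iff)
  ultimately show thesis by (rule that)
qed

text \<open>Index 0 has only its right edge here. In the full chain evenness makes the left edge
  equal to it, so the full equation at 0 is just twice this one.\<close>

lemma critical_half_chain:
  assumes s: "2 \<le> s"
    and curv: "- Re (g2 0) / (Im (g1 0))\<^sup>2 * (2 * Re (g 0)) < 2 * (cos (pi / real (2 * s)))\<^sup>2"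
  obtains d where
    "\<And>k. 2 * k < s \<Longrightarrow> 0 < d k \<and> d k < 1/4"
    "\<And>k. 2 * k < s \<Longrightarrow> (if k = 0 then 0 else chord' (d (k-1)) (d k)) +
      (if 2 * Suc k < s then chord' (d (Suc k)) (d k) else end_term' s (d k)) = 0"
proof -
  define n where "n = (s+1) div 2"
  have n: "k < n \<longleftrightarrow> 2 * k < s" for k by (auto simp: n_def)
  obtain d0 where d0: "\<And>i. d0 i \<in> {0..1/4}" "energy s (\<lambda>_. 0) < energy s d0"
    using energy_gain[OF assms] by blast
  have "\<exists>d. (\<forall>k<n. 0 < d k \<and> d k < 1/4) \<and>
    (\<forall>k<n. (if k = 0 then 0 else chord' (d (k-1)) (d k)) +
      (if Suc k < n then chord' (d (Suc k)) (d k) else end_term' s (d k)) = 0)"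
  proof (rule box_maximum_interior[where f = chord and E = "end_term s" and b = d0])
    show "0 < n" using s by (simp add: n_def)
    show "continuous_on UNIV (\<lambda>p. chord (fst p) (snd p))"
      by (intro continuous_intros continuous_on_compose2[OF g_cont[of UNIV]]) auto
    show "continuous_on UNIV (end_term s)"
      unfolding end_term_def by (cases "even s") (auto intro!: continuous_intros g_cont)
    show "(end_term s has_real_derivative end_term' s b) (at b)" if "b \<in> {0..1/4}" for b
    proof (cases "even s")
      case True
      then have "end_term s = chord 0" by (simp add: end_term_def fun_eq_iff)
      with True show ?thesis using chord_deriv[OF g_add_nonzero[of 0 b]] that
        by (simp add: end_term'_def)
    next
      case False
      then have "end_term s = (\<lambda>y. Re (g y))" by (simp add: end_term_def fun_eq_iff)
      with False show ?thesis by (simp add: end_term'_def Re_deriv)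
    qed
    show "end_term' s 0 = 0"
      by (simp add: end_term'_def chord'_0_0 Re_g1_0)
    show "end_term' s (1/4) < 0"
      using chord'_quarter_neg[of 0] Re_g1_quarter by (simp add: end_term'_def)
    show "(\<Sum>i<n-1. chord 0 0) + end_term s 0 < (\<Sum>i<n-1. chord (d0 i) (d0 (Suc i))) + end_term s (d0 (n-1))"
      using d0(2) by (simp add: energy_def n_def)
    show "(chord a has_real_derivative chord' a b) (at b)" if "a \<in> {0..1/4}" "b \<in> {0..1/4}" for a b
      using chord_deriv g_add_nonzero that by blast
    show "chord a b = chord b a" for a b by (simp add: add.commute)
    show "0 < chord' a 0" if "a \<in> {0<..1/4}" for a using that by (rule chord'_0_pos)
    show "chord' a (1/4) < 0" if "a \<in> {0..<1/4}" for a using that by (rule chord'_quarter_neg)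
    show "d0 i \<in> {0..1/4}" for i by (rule d0)
  qed (simp_all add: chord'_0_0 chord'_quarter)
  then show thesis using that unfolding n by blast
qed

end

section \<open>Alternating chains\<close>

text \<open>Only the symmetries and signs of the displacements, without the curve. The reflections
  of the index line in 0 and s/2 compose to the translation by \<open>s\<close>, which negates
  \<open>d\<close>.\<close>

locale alternating_chain =
  fixes d :: "int \<Rightarrow> real" and s :: int
  assumes s: "2 \<le> s"
    and even: "d (- i) = d i"
    and anti: "d (s - i) = - d i"
    and pos: "0 \<le> i \<Longrightarrow> 2 * i < s \<Longrightarrow> 0 < d i"
begin

lemma shift: "d (i + s) = - d i"
  using anti[of "- i"] even[of i] by (simp add: add.commute)

lemma period: "d (i + 2 * s * k) = d i"
proof (induction k rule: int_induct[where k = 0])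
  case (step1 k)
  then show ?case
    using shift[of "i + 2 * s * k"] shift[of "i + 2 * s * k + s"] by (simp add: algebra_simps)
next
  case (step2 k)
  then show ?case
    using shift[of "i + 2 * s * (k - 1)"] shift[of "i + 2 * s * (k - 1) + s"] by (simp add: algebra_simps)
qed simp

lemma pos': "2 * \<bar>i\<bar> < s \<Longrightarrow> 0 < d i"
  using pos[of "\<bar>i\<bar>"] even[of i] by (cases "0 \<le> i") auto

lemma neg: "s < 2 * i \<Longrightarrow> 2 * i < 3 * s \<Longrightarrow> d i < 0"
proof -
  assume "s < 2 * i" "2 * i < 3 * s"
  then have "2 * \<bar>i - s\<bar> < s" by presburger
  from pos'[OF this] show ?thesis using shift[of "i - s"] by simp
qed

lemma zero: "2 * i = s \<Longrightarrow> d i = 0"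
  using anti[of i] by auto

text \<open>After reduction modulo 2s, a period of length between 1 and s would move the last
  positive index before s/2 into the range where \<open>d\<close> is nonpositive.\<close>

lemma period_dvd:
  assumes "\<And>i. d (i + k) = d i"
  shows "2 * s dvd k"
proof -
  \<comment> \<open>The largest integer below s/2.\<close>
  define m where "m = (s - 1) div 2"
  have m: "2 * m < s" "s \<le> 2 * (m + 1)" "0 \<le> m" using s by (auto simp: m_def)
  have no_period: False if "0 < r" "r \<le> s" "\<And>i. d (i + r) = d i" for r
  proof -
    have "d (m + r) \<le> 0"
      using neg[of "m + r"] zero[of "m + r"] m that by (cases "2 * (m + r) = s") auto
    then show False using that(3)[of m] pos[of m] m by simp
  qed
  define r where "r = k mod (2 * s)"
  have r: "0 \<le> r" "r < 2 * s" using s by (auto simp: r_def)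
  have dr: "d (i + r) = d i" for i
    using period[of "i + r" "k div (2 * s)"] assms[of i] by (simp add: r_def add.assoc)
  have "r = 0"
  proof (rule ccontr)
    assume "r \<noteq> 0"
    show False
    proof (cases "r \<le> s")
      case True
      then show False using no_period[of r] dr r \<open>r \<noteq> 0\<close> by auto
    next
      \<comment> \<open>A period r > s is replaced by 2s - r, which is a period shorter than
        s.\<close>
      case False
      have "d (i + (2 * s - r)) = d i" for i
        using dr[of "i + (2 * s - r)"] period[of i 1] by simp
      with no_period[of "2 * s - r"] False r show False by auto
    qed
  qed
  then show ?thesis by (auto simp: r_def)
qed

text \<open>The signs form one positive and one negative block of the cyclic index line. The changes
  start at the last positive index m and, since translation by \<open>s\<close> negates, at m +
  s.\<close>

lemma sign_changes_eq_2: "sign_changes d (2 * s) = 2"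
proof -
  define m where "m = (s - 1) div 2"
  have m: "2 * m < s" "s \<le> 2 * (m + 1)" "0 \<le> m" using s by (auto simp: m_def)
  define change where "change i \<longleftrightarrow> d i \<noteq> 0 \<and> (\<exists>j>i. d i * d j < 0 \<and> (\<forall>l. i < l \<and> l < j \<longrightarrow> d l = 0))" for i
  have dm: "0 < d m" using m by (intro pos) auto
  have cm: "change m"
  proof (cases "2 * (m + 1) = s")
    \<comment> \<open>For even \<open>s\<close> there is a zero at s/2 = m + 1, so the next nonzero
      entry is at m + 2.\<close>
    case True
    have "d (m + 2) < 0" using m True s by (intro neg; presburger)
    moreover have "d l = 0" if "m < l \<and> l < m + 2" for l
    proof -
      have "l = m + 1" using that by simp
      with True show ?thesis by (auto intro: zero)
    qed
    ultimately show ?thesis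
      unfolding change_def using dm by (intro conjI exI[of _ "m + 2"]) (auto simp: mult_pos_neg)
  next
    case False
    then have "d (m + 1) < 0" using m s by (intro neg; presburger)
    then show ?thesis
      unfolding change_def using dm by (intro conjI exI[of _ "m + 1"]) (auto simp: mult_pos_neg)
  qed
  have cms: "change (m + s)"
  proof -
    obtain j where j: "j > m" "d m * d j < 0" "\<And>l. m < l \<and> l < j \<Longrightarrow> d l = 0"
      using cm unfolding change_def by blast
    have "d l = 0" if "m + s < l \<and> l < j + s" for l
      using j(3)[of "l - s"] shift[of "l - s"] that by (simp add: algebra_simps)
    then show ?thesis
      unfolding change_def using j dm by (intro conjI exI[of _ "j + s"]) (auto simp: shift)
  qed
  have "i = m \<or> i = m + s" if i: "0 \<le> i" "i < 2 * s" and c: "change i" for i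
  proof (rule ccontr)
    assume ne: "\<not> (i = m \<or> i = m + s)"
    have "d i \<noteq> 0" using c by (simp add: change_def)
    then have "2 * i \<noteq> s" using zero by blast
    have "2 * i \<noteq> 3 * s" using \<open>d i \<noteq> 0\<close> zero[of "i - s"] shift[of "i - s"] by auto
    \<comment> \<open>Away from the block ends the next entry is nonzero with the same sign, so it
      cannot be skipped and no change starts at i.\<close>
    have "0 < d i * d (i + 1)"
    proof -
      consider "2 * i < s" | "s < 2 * i" "2 * i < 3 * s" | "3 * s < 2 * i"
        using \<open>2 * i \<noteq> s\<close> \<open>2 * i \<noteq> 3 * s\<close> by (meson linorder_less_linear)
      then show ?thesis
      proof cases
        case 1
        then have "i < m" using m ne by presburger
        then show ?thesis using m i 1 by (intro mult_pos_pos pos; presburger)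
      next
        case 2
        then have "i < m + s" using m ne by presburger
        then show ?thesis using m 2 by (intro mult_neg_neg neg; presburger)
      next
        case 3
        have "0 < d (i - 2 * s)" "0 < d (i - 2 * s + 1)" using 3 i s by (intro pos'; presburger)+
        then show ?thesis
          using period[of "i - 2 * s" 1] period[of "i - 2 * s + 1" 1] by (simp add: add.commute)
      qed
    qed
    moreover obtain j where j: "j > i" "d i * d j < 0" "\<And>l. i < l \<and> l < j \<Longrightarrow> d l = 0"
      using c unfolding change_def by blast
    ultimately have "j \<noteq> i + 1" "d (i + 1) \<noteq> 0" by auto
    with j(1) j(3)[of "i + 1"] show False by auto
  qed
  then have "{i \<in> {0..<2 * s}. change i} = {m, m + s}"
    using cm cms m s by auto
  then show ?thesis
    using s by (simp add: sign_changes_def change_def)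
qed

end

text \<open>\<open>j i\<close> is the distance from i to the nearest multiple of 2s: it folds the
  integers onto the fundamental domain {0..s} of the group generated by i -> -i and i -> i +
  2s.\<close>

lemma fold_index:
  fixes i s :: int
  assumes "0 < s"
  defines "j \<equiv> \<lambda>i. min (i mod (2 * s)) (2 * s - i mod (2 * s))"
  shows "0 \<le> j i" "j i \<le> s" "j (- i) = j i" "j (s - i) = s - j i"
    "\<exists>k. i = j i + 2 * s * k \<or> i = - j i + 2 * s * k"
    "0 \<le> i \<Longrightarrow> i \<le> s \<Longrightarrow> j i = i"
proof -
  define r where "r = i mod (2 * s)"
  have r: "0 \<le> r" "r < 2 * s" using assms by (auto simp: r_def)
  have i: "i = r + 2 * s * (i div (2 * s))" by (simp add: r_def)
  have mod: "m mod (2 * s) = t" if "0 \<le> t" "t < 2 * s" "m = t + 2 * s * k" for m t k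
    using that by simp
  show "0 \<le> j i" "j i \<le> s" using r by (auto simp: j_def r_def[symmetric])
  have "(- i) mod (2 * s) = (if r = 0 then 0 else 2 * s - r)"
    using r i by (intro mod[of _ _ "- (i div (2 * s)) - (if r = 0 then 0 else 1)"]) (auto simp: algebra_simps)
  then show "j (- i) = j i" using r by (auto simp: j_def r_def[symmetric])
  have "(s - i) mod (2 * s) = (if r \<le> s then s - r else 3 * s - r)"
    using r i assms(1) by (intro mod[of _ _ "- (i div (2 * s)) - (if r \<le> s then 0 else 1)"]) (auto simp: algebra_simps)
  then show "j (s - i) = s - j i" using r by (auto simp: j_def r_def[symmetric])
  show "\<exists>k. i = j i + 2 * s * k \<or> i = - j i + 2 * s * k"
  proof (cases "r \<le> s")
    case True
    then have "j i = r" by (simp add: j_def r_def[symmetric])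
    then show ?thesis using i by metis
  next
    case False
    then have "j i = 2 * s - r" by (simp add: j_def r_def[symmetric])
    then have "i = - j i + 2 * s * (i div (2 * s) + 1)" using i by (simp add: algebra_simps)
    then show ?thesis by blast
  qed
  show "0 \<le> i \<Longrightarrow> i \<le> s \<Longrightarrow> j i = i" using assms(1) by (simp add: j_def)
qed

section \<open>Symmetric extension of the half chain and the reflection law\<close>

context symmetric_oval
begin

text \<open>Symmetric criticality by hand: the gradient \<open>G\<close> of the length is even,
  2s-periodic and antisymmetric about s/2, so its vanishing on the half chain spreads to all
  indices, the midpoint included.\<close>

lemma symmetric_critical_chain:
  fixes s :: int
  assumes s: "2 \<le> s"
    and curv: "- Re (g2 0) / (Im (g1 0))\<^sup>2 * (2 * Re (g 0)) < 2 * (cos (pi / real_of_int (2 * s)))\<^sup>2"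
  obtains d where "alternating_chain d s" "\<And>i. \<bar>d i\<bar> < 1/4"
    "\<And>i. chord' (d (i - 1)) (d i) + chord' (d (i + 1)) (d i) = 0"
proof -
  have s': "2 \<le> nat s" "real (2 * nat s) = real_of_int (2 * s)" using s by auto
  obtain b where b: "\<And>k. 2 * k < nat s \<Longrightarrow> 0 < b k \<and> b k < 1/4"
    "\<And>k. 2 * k < nat s \<Longrightarrow> (if k = 0 then 0 else chord' (b (k-1)) (b k)) +
      (if 2 * Suc k < nat s then chord' (b (Suc k)) (b k) else end_term' (nat s) (b k)) = 0"
    using critical_half_chain[OF s'(1), unfolded s'(2), OF curv] by blast
  define J where "J i = min (i mod (2 * s)) (2 * s - i mod (2 * s))" for i
  have J: "0 \<le> J i" "J i \<le> s" "J (- i) = J i" "J (s - i) = s - J i"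
    "\<exists>k. i = J i + 2 * s * k \<or> i = - J i + 2 * s * k" "0 \<le> i \<Longrightarrow> i \<le> s \<Longrightarrow> J i = i" for i
    using fold_index[of s i] s unfolding J_def by auto
  define d where "d i = (if 2 * J i < s then b (nat (J i)) else if 2 * J i = s then 0 else - b (nat (s - J i)))" for i
  have d: "d i = b (nat i)" if "0 \<le> i" "2 * i < s" for i
    using that J(6)[of i] by (simp add: d_def)
  have bound: "\<bar>d i\<bar> < 1/4" for i
  proof -
    consider "2 * J i < s" | "2 * J i = s" | "2 * J i > s" by linarith
    then show ?thesis
    proof cases
      case 1
      then have "2 * nat (J i) < nat s" using J(1)[of i] by linarith
      with 1 b(1) show ?thesis by (force simp: d_def)
    next
      case 3
      then have "2 * nat (s - J i) < nat s" using J(2)[of i] by linarith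
      with 3 b(1) show ?thesis by (force simp: d_def)
    qed (simp add: d_def)
  qed
  interpret alternating_chain d s
  proof
    show "d (- i) = d i" for i by (simp add: d_def J)
    show "d (s - i) = - d i" for i by (auto simp: d_def J)
    show "0 < d i" if "0 \<le> i" "2 * i < s" for i
    proof -
      have "2 * nat i < nat s" using that by linarith
      then show ?thesis using b(1) d[OF that] by simp
    qed
  qed (rule s)
  define G where "G i = chord' (d (i - 1)) (d i) + chord' (d (i + 1)) (d i)" for i
  have G_even: "G (- i) = G i" for i
  proof -
    have "- i - 1 = - (i + 1)" "- i + 1 = - (i - 1)" by simp_all
    then show ?thesis by (simp only: G_def even add.commute)
  qed
  have G_period: "G (i + 2 * s * k) = G i" for i k
  proof -
    have "i + 2 * s * k - 1 = (i - 1) + 2 * s * k" "i + 2 * s * k + 1 = (i + 1) + 2 * s * k" by simp_all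
    then show ?thesis by (simp only: G_def period)
  qed
  have G_anti: "G (s - i) = - G i" for i
  proof -
    have "s - i - 1 = s - (i + 1)" "s - i + 1 = s - (i - 1)" by simp_all
    then show ?thesis by (simp only: G_def anti chord'_minus)
  qed
  have G_base: "G i = 0" if i: "0 \<le> i" "2 * i < s" for i
  proof -
    define k where "k = nat i"
    have k: "i = int k" "2 * k < nat s" using i by (auto simp: k_def)
    \<comment> \<open>At the end of the half chain the extension supplies the neighbour: 0 at the
      midpoint for even \<open>s\<close>, and the opposite displacement for odd
      \<open>s\<close>.\<close>
    have right: "chord' (d (i + 1)) (d i) =
        (if 2 * Suc k < nat s then chord' (b (Suc k)) (b k) else end_term' (nat s) (b k))"
    proof (cases "2 * Suc k < nat s")
      case True
      then have "d (i + 1) = b (Suc k)" using d[of "i + 1"] k i by (auto simp: nat_add_distrib)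
      with True show ?thesis using d[OF i] by (simp add: k_def)
    next
      case False
      show ?thesis
      proof (cases "2 * (i + 1) = s")
        case True
        then have "Parity.even s" by presburger
        then have "Parity.even (nat s)" using s by (simp add: even_nat_iff)
        with True False show ?thesis
          using zero[of "i + 1"] d[OF i] by (simp add: end_term'_def k_def)
      next
        case ne: False
        have "s \<le> 2 * i + 2" using False k(1) by (simp add: not_less nat_le_iff)
        with ne i have eq: "s = 2 * i + 1" by presburger
        then have "odd (nat s)" using s by (simp add: even_nat_iff)
        moreover have "d (i + 1) = - d i" using anti[of i] eq by (simp add: algebra_simps)
        ultimately show ?thesis
          using False chord'_antipodal[OF bound[of i]] d[OF i] by (simp add: end_term'_def k_def)
      qed
    qed
    show ?thesis
    proof (cases "i = 0")
      case True
      then show ?thesis using right b(2)[OF k(2)] even[of 1] by (simp add: G_def k_def)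
    next
      case False
      then have "d (i - 1) = b (k - 1)" using d[of "i - 1"] i k by (simp add: nat_diff_distrib)
      then have "chord' (d (i - 1)) (d i) = chord' (b (k - 1)) (b k)"
        using d[OF i] by (simp add: k_def)
      then show ?thesis using right b(2)[OF k(2)] False i by (simp add: G_def k_def)
    qed
  qed
  have G_fold: "G i = 0" if i: "0 \<le> i" "i \<le> s" for i
  proof -
    have "2 * i < s \<or> 2 * i = s \<or> 2 * (s - i) < s" by presburger
    then consider "2 * i < s" | "2 * i = s" | "2 * (s - i) < s" by blast
    then show ?thesis
    proof cases
      case 2
      then have "s - i = i" by simp
      then show ?thesis using G_anti[of i] by simp
    next
      case 3
      then show ?thesis using G_anti[of i] G_base[of "s - i"] i by simp
    qed (use G_base i in auto)
  qed
  have "G i = 0" for i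
  proof -
    obtain k where "i = J i + 2 * s * k \<or> i = - J i + 2 * s * k" using J(5) by blast
    then have "G i = G (J i)" using G_period[of _ k] G_even by metis
    then show ?thesis using G_fold J(1,2) by simp
  qed
  then show thesis
    using that[of d] bound alternating_chain_axioms by (simp add: G_def)
qed

text \<open>Criticality says that two unit directions have opposite tangential components. Then
  either the reflection law holds or the directions are opposite, and the latter is impossible as
  both have positive real part. The minus sign reflects the half turn between consecutive impact
  points in the normalised picture.\<close>

lemma reflection:
  assumes abc: "\<bar>a\<bar> < 1/4" "\<bar>b\<bar> < 1/4" "\<bar>c\<bar> < 1/4" and crit: "chord' a b + chord' c b = 0"
  shows "sgn (g b + g c) = - ((sgn (g1 b))\<^sup>2 * cnj (sgn (g a + g b)))"
proof -
  define U V \<tau> where "U = sgn (g a + g b)" and "V = sgn (g c + g b)" and "\<tau> = sgn (g1 b)"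
  have Re: "0 < Re (g a + g b)" "0 < Re (g c + g b)"
    using Re_pos abc by (auto intro: add_pos_pos)
  then have nz: "g a + g b \<noteq> 0" "g c + g b \<noteq> 0" by force+
  have norms: "cmod U = 1" "cmod V = 1" "cmod \<tau> = 1"
    using nz regular[of b] by (auto simp: U_def V_def \<tau>_def norm_sgn)
  have Re_UV: "0 < Re U" "0 < Re V"
    using Re nz by (auto simp: U_def V_def Re_sgn simp del: plus_complex.sel)
  have g1: "g1 b = of_real (cmod (g1 b)) * \<tau>"
    by (simp add: \<tau>_def sgn_eq)
  have "cmod (g1 b) * Re (cnj \<tau> * U) + cmod (g1 b) * Re (cnj \<tau> * V) = chord' a b + chord' c b"
    unfolding chord'_def U_def[symmetric] V_def[symmetric] 
    by (subst (3 4) g1) (simp add: inner_complex_def algebra_simps)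
  then have "cmod (g1 b) * (Re (cnj \<tau> * U) + Re (cnj \<tau> * V)) = 0"
    using crit by (simp only: distrib_left)
  then have ReUV: "Re (cnj \<tau> * V) = - Re (cnj \<tau> * U)"
    using regular[of b] by (simp add: eq_neg_iff_add_eq_0 add.commute)
  have "(cmod (cnj \<tau> * U))\<^sup>2 = 1" "(cmod (cnj \<tau> * V))\<^sup>2 = 1"
    using norms by (simp_all add: norm_mult)
  then have "(Im (cnj \<tau> * V))\<^sup>2 = (Im (cnj \<tau> * U))\<^sup>2"
    unfolding cmod_power2 ReUV power2_minus by linarith
  then consider "Im (cnj \<tau> * V) = Im (cnj \<tau> * U)" | "Im (cnj \<tau> * V) = - Im (cnj \<tau> * U)"
    using power2_eq_iff by blast
  then have "V = - (\<tau>\<^sup>2 * cnj U)"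
  proof cases
    case 1
    have \<tau>\<tau>: "\<tau> * cnj \<tau> = 1" using norms(3) by (simp add: complex_norm_square[symmetric])
    have "cnj \<tau> * V = - cnj (cnj \<tau> * U)"
      using 1 ReUV by (intro complex_eqI) auto
    then have "\<tau> * cnj \<tau> * V = - (\<tau>\<^sup>2 * cnj U)"
      by (simp add: power2_eq_square mult.assoc)
    then show ?thesis by (simp add: \<tau>\<tau>)
  next
    case 2
    have "cnj \<tau> * V = cnj \<tau> * (- U)"
      using 2 ReUV by (intro complex_eqI) auto
    moreover have "cnj \<tau> \<noteq> 0" using norms(3) by auto
    ultimately have "V = - U" by (metis mult_left_cancel)
    with Re_UV show ?thesis by simp
  qed
  then show ?thesis by (simp add: U_def V_def \<tau>_def add.commute)
qed

end

section \<open>Orientation of the curve\<close>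

context
  fixes \<gamma> :: "real \<Rightarrow> complex"
  assumes curve: "billiard_curve \<gamma>" and equi: "equivariant \<gamma>"
begin

lemma curve_eq_iff: "\<gamma> a = \<gamma> b \<longleftrightarrow> a - b \<in> \<int>"
  using curve by (simp add: billiard_curve_def)

lemma curve_half: "\<gamma> (t + 1/2) = - \<gamma> t"
  and curve_minus: "\<gamma> (- t) = cnj (\<gamma> t)"
  using equi by (simp_all add: equivariant_def rotR_def reflS_def)

lemma vel_deriv: "(\<gamma> has_vector_derivative vel \<gamma> t) (at t)"
  and acc_deriv: "(vel \<gamma> has_vector_derivative acc \<gamma> t) (at t)"
proof -
  obtain h1 h2 where h: "\<And>t. (\<gamma> has_vector_derivative h1 t) (at t)"
      "\<And>t. (h1 has_vector_derivative h2 t) (at t)"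
    using curve unfolding billiard_curve_def C2_curve_def by blast
  have "vel \<gamma> = h1" using h(1) by (auto simp: vel_def vector_derivative_at)
  then show "(\<gamma> has_vector_derivative vel \<gamma> t) (at t)" "(vel \<gamma> has_vector_derivative acc \<gamma> t) (at t)"
    using h vector_derivative_at[OF h(2)] by (simp_all add: acc_def)
qed

lemma vel_nonzero: "vel \<gamma> t \<noteq> 0"
  using curve by (simp add: billiard_curve_def)

lemma curve_cont: "continuous_on A \<gamma>"
  using vel_deriv continuous_at_imp_continuous_on has_vector_derivative_continuous by blast

lemma curve_nonzero: "\<gamma> t \<noteq> 0"
proof
  assume "\<gamma> t = 0"
  then have "\<gamma> (t + 1/2) = \<gamma> t" by (simp only: curve_half) simp
  then have "(1/2 :: real) \<in> \<int>" by (simp add: curve_eq_iff)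
  then show False by (auto elim!: Ints_cases)
qed

text \<open>By strict convexity the open segment between antipodal points of the curve is interior,
  hence free of curve points.\<close>

lemma curve_not_between_antipodes: "\<gamma> b \<noteq> of_real l * \<gamma> a" if "\<bar>l\<bar> < 1"
proof
  assume b: "\<gamma> b = of_real l * \<gamma> a"
  obtain K where K: "compact K" "strictly_convex_set K" "frontier K = range \<gamma>"
    using curve unfolding billiard_curve_def by blast
  have inK: "\<gamma> t \<in> K" for t
    using K by (metis compact_imp_closed frontier_subset_closed rangeI subsetD)
  have "\<gamma> a \<noteq> - \<gamma> a" using curve_nonzero by simp
  moreover have "- \<gamma> a \<in> K" using inK[of "a + 1/2"] by (simp add: curve_half)
  ultimately have "open_segment (\<gamma> a) (- \<gamma> a) \<subseteq> interior K"
    using K(2) inK unfolding strictly_convex_set_def by blast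
  moreover have "\<gamma> b \<in> open_segment (\<gamma> a) (- \<gamma> a)"
    unfolding in_segment using that curve_nonzero
    by (intro conjI exI[of _ "(1 - l) / 2"]) (auto simp: b scaleR_conv_of_real field_simps)
  moreover have "\<gamma> b \<in> frontier K" using K by blast
  ultimately show False by (auto simp: frontier_def)
qed

lemma zero_in_interior:
  assumes "compact K" "strictly_convex_set K" "frontier K = range \<gamma>"
  shows "0 \<in> interior K"
proof -
  have inK: "\<gamma> t \<in> K" for t
    using assms by (metis compact_imp_closed frontier_subset_closed rangeI subsetD)
  have "\<gamma> 0 \<noteq> - \<gamma> 0" using curve_nonzero by simp
  moreover have "- \<gamma> 0 \<in> K" using inK[of "0 + 1/2"] by (simp only: curve_half)
  ultimately have "open_segment (\<gamma> 0) (- \<gamma> 0) \<subseteq> interior K"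
    using assms(2) inK unfolding strictly_convex_set_def by blast
  moreover have "0 \<in> open_segment (\<gamma> 0) (- \<gamma> 0)"
    unfolding in_segment using curve_nonzero
    by (intro conjI exI[of _ "1/2"]) auto
  ultimately show ?thesis by blast
qed

section \<open>Counterclockwise orientation from the winding number\<close>

definition curve_cross :: "real \<Rightarrow> real \<Rightarrow> real" where
  "curve_cross a b = Im (cnj (\<gamma> a) * \<gamma> b)"

text \<open>A vanishing cross product makes one point a real multiple l of the other. Neither l nor
  1/l can have modulus below 1, so l is 1 or -1 and h would be a multiple of 1/2.\<close>

lemma curve_cross_nonzero:
  assumes "0 < h" "h < 1/2"
  shows "curve_cross a (a + h) \<noteq> 0"
proof
  assume "curve_cross a (a + h) = 0"
  then have "Im (\<gamma> (a + h) / \<gamma> a) = 0"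
    by (simp add: curve_cross_def Im_complex_div_eq_0 mult.commute)
  then have "\<gamma> (a + h) / \<gamma> a = of_real (Re (\<gamma> (a + h) / \<gamma> a))"
    by (simp add: complex_eq_iff)
  then obtain l where l: "\<gamma> (a + h) = of_real l * \<gamma> a"
    using curve_nonzero by (metis nonzero_divide_eq_eq)
  have "\<not> \<bar>l\<bar> < 1" using l curve_not_between_antipodes by blast
  moreover have "\<not> \<bar>1 / l\<bar> < 1"
  proof -
    have "l \<noteq> 0" using l curve_nonzero by auto
    then have "\<gamma> a = of_real (1 / l) * \<gamma> (a + h)" using l by (simp add: field_simps)
    then show ?thesis using curve_not_between_antipodes by blast
  qed
  ultimately have "\<bar>l\<bar> = 1" by (auto simp: field_simps split: if_splits)
  then have "\<gamma> (a + h) = \<gamma> a \<or> \<gamma> (a + h) = \<gamma> (a + 1/2)"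
    unfolding curve_half using l by (auto simp: abs_if split: if_splits)
  then have "h \<in> \<int> \<or> h - 1/2 \<in> \<int>" by (simp add: curve_eq_iff)
  then obtain k :: int where "h = k \<or> h - 1/2 = k" by (auto elim!: Ints_cases)
  with assms have "0 < k \<and> k < 1 \<or> -1 < k \<and> k < 0" by linarith
  then show False by auto
qed

text \<open>A continuous function without zeros on a connected strip has one sign.\<close>

lemma curve_cross_sign:
  assumes "0 < h" "h < 1/2" "0 < h'" "h' < 1/2" "curve_cross a (a + h) < 0"
  shows "curve_cross a' (a' + h') < 0"
proof (rule ccontr)
  assume "\<not> curve_cross a' (a' + h') < 0"
  let ?S = "UNIV \<times> {0<..<1/2} :: (real \<times> real) set"
  let ?f = "\<lambda>p. curve_cross (fst p) (fst p + snd p)"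
  have "continuous_on ?S ?f"
    unfolding curve_cross_def by (intro continuous_intros continuous_on_compose2[OF curve_cont[of UNIV]]) auto
  then have "connected (?f ` ?S)"
    by (intro connected_continuous_image connected_Times) auto
  moreover have "?f (a, h) \<in> ?f ` ?S" "?f (a', h') \<in> ?f ` ?S"
    using assms by (intro imageI; simp)+
  ultimately have "{?f (a, h)..?f (a', h')} \<subseteq> ?f ` ?S"
    by (rule connected_contains_Icc)
  then have "0 \<in> ?f ` ?S"
    using assms(5) \<open>\<not> curve_cross a' (a' + h') < 0\<close> by auto
  then show False using curve_cross_nonzero by auto
qed

text \<open>Multiplication by \<open>\<i> * cnj (\<gamma> c)\<close> moves the half turn into the
  right half-plane, from the positive to the negative imaginary axis, where the principal logarithm
  is a primitive.\<close>

lemma clockwise_half_turn: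
  assumes neg: "\<And>h. 0 < h \<Longrightarrow> h < 1/2 \<Longrightarrow> curve_cross c (c + h) < 0"
  shows "((\<lambda>t. vel \<gamma> t / \<gamma> t) has_integral - (\<i> * pi)) {c..c + 1/2}"
proof -
  define r where "r = (cmod (\<gamma> c))\<^sup>2"
  have r: "0 < r" "cnj (\<gamma> c) * \<gamma> c = of_real r"
    using curve_nonzero[of c] complex_norm_square[of "\<gamma> c"] by (auto simp: r_def mult.commute)
  let ?w = "\<lambda>t. \<i> * cnj (\<gamma> c) * \<gamma> t"
  have w: "?w t \<notin> \<real>\<^sub>\<le>\<^sub>0" if "t \<in> {c..c + 1/2}" for t
  proof (cases "t = c \<or> t = c + 1/2")
    case True
    then have "?w t = \<i> * of_real r \<or> ?w t = - (\<i> * of_real r)"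
      using r(2) curve_half[of c] by (auto simp: mult.assoc)
    then have "Im (?w t) \<noteq> 0" using r(1) by (metis Im_i_times Re_complex_of_real neg_equal_0_iff_equal less_irrefl uminus_complex.sel(2))
    then show ?thesis by (simp only: complex_nonpos_Reals_iff) simp
  next
    case False
    then have "0 < Re (?w t)" using neg[of "t - c"] that by (simp add: curve_cross_def mult.assoc)
    then show ?thesis unfolding complex_nonpos_Reals_iff by linarith
  qed
  have "((\<lambda>t. Ln (?w t)) has_vector_derivative vel \<gamma> t / \<gamma> t) (at t within {c..c + 1/2})"
    if "t \<in> {c..c + 1/2}" for t
  proof -
    have "((\<lambda>t. ?w t) has_vector_derivative \<i> * cnj (\<gamma> c) * vel \<gamma> t) (at t)"
      by (intro has_vector_derivative_mult_right vel_deriv)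
    from field_vector_diff_chain_at[OF this has_field_derivative_Ln[OF w[OF that]]]
    have "((\<lambda>t. Ln (?w t)) has_vector_derivative vel \<gamma> t / \<gamma> t) (at t)"
      using curve_nonzero by (simp add: o_def field_simps)
    then show ?thesis by (rule has_vector_derivative_at_within)
  qed
  then have "((\<lambda>t. vel \<gamma> t / \<gamma> t) has_integral (Ln (?w (c + 1/2)) - Ln (?w c))) {c..c + 1/2}"
    by (intro fundamental_theorem_of_calculus) auto
  moreover have "?w (c + 1/2) = of_real r * (- \<i>)" "?w c = of_real r * \<i>"
    using r(2) by (auto simp: curve_half mult.commute mult.left_commute)
  moreover have "Ln (of_real r * (- \<i>)) - Ln (of_real r * \<i>) = - (\<i> * pi)"
    using Ln_times_of_real[OF r(1), of "- \<i>"] Ln_times_of_real[OF r(1), of \<i>] by simp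
  ultimately show ?thesis by (simp only:)
qed

text \<open>The opposite sign would make the curve two clockwise half turns about 0, hence of
  winding number -1.\<close>

lemma curve_cross_pos:
  assumes "0 < h" "h < 1/2"
  shows "0 < curve_cross a (a + h)"
proof (rule ccontr)
  assume "\<not> 0 < curve_cross a (a + h)"
  then have "curve_cross a (a + h) < 0" using curve_cross_nonzero[OF assms, of a] by simp
  then have neg: "curve_cross a' (a' + h') < 0" if "0 < h'" "h' < 1/2" for a' h'
    using curve_cross_sign assms that by blast
  obtain K where K: "compact K" "strictly_convex_set K" "frontier K = range \<gamma>"
    "\<And>w. w \<in> interior K \<Longrightarrow> winding_number \<gamma> w = 1"
    using curve unfolding billiard_curve_def by blast
  have wn: "winding_number \<gamma> 0 = 1" using K(4) zero_in_interior[OF K(1-3)] .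
  have "continuous_on A (vel \<gamma>)" for A
    using acc_deriv continuous_at_imp_continuous_on has_vector_derivative_continuous by blast
  then have "valid_path \<gamma>"
    unfolding valid_path_def using vel_deriv
    by (intro C1_differentiable_imp_piecewise) (auto simp: C1_differentiable_on_def)
  moreover have "0 \<notin> path_image \<gamma>"
    using curve_nonzero by (auto simp: path_image_def)
  ultimately have "winding_number \<gamma> 0 = 1 / (2 * pi * \<i>) * contour_integral \<gamma> (\<lambda>w. 1 / (w - 0))"
    by (rule winding_number_valid_path)
  also have "contour_integral \<gamma> (\<lambda>w. 1 / (w - 0)) = integral {0..1} (\<lambda>t. vel \<gamma> t / \<gamma> t)"
    by (simp add: contour_integral_integral vel_def)
  also have "\<dots> = - (\<i> * pi) + - (\<i> * pi)"
  proof (rule integral_unique)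
    have "((\<lambda>t. vel \<gamma> t / \<gamma> t) has_integral - (\<i> * pi)) {0..1/2}"
      using clockwise_half_turn[of 0] neg[of _ 0] by simp
    moreover have "((\<lambda>t. vel \<gamma> t / \<gamma> t) has_integral - (\<i> * pi)) {1/2..1}"
      using clockwise_half_turn[of "1/2"] neg[of _ "1/2"] by simp
    ultimately show "((\<lambda>t. vel \<gamma> t / \<gamma> t) has_integral - (\<i> * pi) + - (\<i> * pi)) {0..1}"
      by (intro has_integral_combine[of 0 "1/2" 1]) auto
  qed
  finally show False using wn by (simp add: field_simps)
qed

text \<open>The rotation satisfies \<open>\<omega> * \<epsilon> = cnj \<omega>\<close>, which turns
  the given reflection into plain conjugation.\<close>

lemma symmetric_oval_normalized:
  assumes \<epsilon>: "\<And>t. \<gamma> (t\<^sub>0 - t) = \<epsilon> * cnj (\<gamma> (t\<^sub>0 + t))"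
  defines "\<omega> \<equiv> cnj (sgn (\<gamma> t\<^sub>0))"
  shows "symmetric_oval (\<lambda>t. \<omega> * \<gamma> (t\<^sub>0 + t)) (\<lambda>t. \<omega> * vel \<gamma> (t\<^sub>0 + t)) (\<lambda>t. \<omega> * acc \<gamma> (t\<^sub>0 + t))"
proof
  have \<omega>: "cmod \<omega> = 1" using curve_nonzero by (simp add: \<omega>_def norm_sgn)
  then have "\<omega> \<noteq> 0" by auto
  have shift: "((\<lambda>t. t\<^sub>0 + t) has_vector_derivative 1) (at t)" for t
    by (auto intro!: derivative_eq_intros)
  have \<omega>\<epsilon>: "\<omega> * \<epsilon> = cnj \<omega>"
  proof -
    have e: "\<gamma> t\<^sub>0 = \<epsilon> * cnj (\<gamma> t\<^sub>0)" using \<epsilon>[of 0] by simp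
    have "cnj \<omega> = \<gamma> t\<^sub>0 / cmod (\<gamma> t\<^sub>0)" by (simp add: \<omega>_def sgn_eq)
    also have "\<dots> = \<epsilon> * (cnj (\<gamma> t\<^sub>0) / cmod (\<gamma> t\<^sub>0))" by (subst e) simp
    also have "\<dots> = \<omega> * \<epsilon>" by (simp add: \<omega>_def sgn_eq)
    finally show ?thesis by simp
  qed
  fix t
  show "((\<lambda>t. \<omega> * \<gamma> (t\<^sub>0 + t)) has_vector_derivative \<omega> * vel \<gamma> (t\<^sub>0 + t)) (at t)"
    using vector_diff_chain_at[OF shift vel_deriv] by (intro has_vector_derivative_mult_right) (simp add: o_def)
  show "((\<lambda>t. \<omega> * vel \<gamma> (t\<^sub>0 + t)) has_vector_derivative \<omega> * acc \<gamma> (t\<^sub>0 + t)) (at t)"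
    using vector_diff_chain_at[OF shift acc_deriv] by (intro has_vector_derivative_mult_right) (simp add: o_def)
  show "\<omega> * vel \<gamma> (t\<^sub>0 + t) \<noteq> 0"
    using \<open>\<omega> \<noteq> 0\<close> vel_nonzero by simp
  show "a - b \<in> \<int>" if "\<omega> * \<gamma> (t\<^sub>0 + a) = \<omega> * \<gamma> (t\<^sub>0 + b)" for a b
    using that \<open>\<omega> \<noteq> 0\<close> by (simp add: curve_eq_iff)
  show "\<omega> * \<gamma> (t\<^sub>0 + - t) = cnj (\<omega> * \<gamma> (t\<^sub>0 + t))"
    using \<epsilon>[of t] \<omega>\<epsilon> by (simp add: mult.assoc[symmetric])
  show half: "\<omega> * \<gamma> (t\<^sub>0 + (t + 1/2)) = - (\<omega> * \<gamma> (t\<^sub>0 + t))" for t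
    using curve_half[of "t\<^sub>0 + t"] by (simp add: add.assoc)
  have rotated_cross: "Im (cnj (\<omega> * \<gamma> (t\<^sub>0 + a)) * (\<omega> * \<gamma> (t\<^sub>0 + b))) = curve_cross (t\<^sub>0 + a) (t\<^sub>0 + b)" for a b
  proof -
    have "\<omega> * cnj \<omega> = 1" using \<omega> by (simp add: complex_norm_square[symmetric])
    moreover have "cnj (\<omega> * \<gamma> (t\<^sub>0 + a)) * (\<omega> * \<gamma> (t\<^sub>0 + b)) =
        \<omega> * cnj \<omega> * (cnj (\<gamma> (t\<^sub>0 + a)) * \<gamma> (t\<^sub>0 + b))"
      by (simp add: mult_ac)
    ultimately show ?thesis by (simp only: curve_cross_def mult_1)
  qed
  have g0: "\<omega> * \<gamma> t\<^sub>0 = cmod (\<gamma> t\<^sub>0)"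
    using curve_nonzero[of "t\<^sub>0"] complex_norm_square[of "\<gamma> t\<^sub>0"]
    by (simp add: \<omega>_def sgn_eq mult.commute power2_eq_square divide_eq_eq)
  show Im: "0 < Im (\<omega> * \<gamma> (t\<^sub>0 + t))" if "0 < t" "t < 1/2" for t
  proof -
    have "Im (cnj (\<omega> * \<gamma> (t\<^sub>0 + 0)) * (\<omega> * \<gamma> (t\<^sub>0 + t))) = cmod (\<gamma> t\<^sub>0) * Im (\<omega> * \<gamma> (t\<^sub>0 + t))"
      unfolding add_0_right g0 by simp
    then have "0 < cmod (\<gamma> t\<^sub>0) * Im (\<omega> * \<gamma> (t\<^sub>0 + t))"
      using rotated_cross[of 0 t] curve_cross_pos[OF that, of "t\<^sub>0"] by (simp only: add_0_right)
    then show ?thesis by (rule zero_less_mult_pos) (use curve_nonzero in simp)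
  qed
  show "0 < Re (\<omega> * \<gamma> (t\<^sub>0 + t))" if t: "\<bar>t\<bar> < 1/4"
  proof -
    \<comment> \<open>The symmetries put the point at parameter 1/4 on the positive imaginary axis,
      so the cross product with it reads off the real part.\<close>
    define q where "q = \<omega> * \<gamma> (t\<^sub>0 + 1/4)"
    have "q = - (\<omega> * \<gamma> (t\<^sub>0 + -1/4))" using half[of "-1/4"] by (simp add: q_def)
    also have "\<omega> * \<gamma> (t\<^sub>0 + -1/4) = cnj q"
      using \<epsilon>[of "1/4"] \<omega>\<epsilon> by (simp add: q_def mult.assoc[symmetric])
    finally have "Re q = 0" by (simp add: complex_eq_iff)
    have "0 < Im q" unfolding q_def by (rule Im) auto
    have "Im (cnj (\<omega> * \<gamma> (t\<^sub>0 + t)) * q) = Re (\<omega> * \<gamma> (t\<^sub>0 + t)) * Im q"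
      using \<open>Re q = 0\<close> by simp
    moreover have "0 < curve_cross (t\<^sub>0 + t) (t\<^sub>0 + t + (1/4 - t))"
      using t by (intro curve_cross_pos) auto
    then have "0 < curve_cross (t\<^sub>0 + t) (t\<^sub>0 + 1/4)" by simp
    ultimately have "0 < Re (\<omega> * \<gamma> (t\<^sub>0 + t)) * Im q"
      using rotated_cross[of t "1/4"] \<open>Im (cnj _ * q) = _\<close> unfolding q_def[symmetric] by (simp only:)
    then show ?thesis using \<open>0 < Im q\<close> by (rule zero_less_mult_pos2)
  qed
qed

end

section \<open>The orbit\<close>

context
  fixes \<gamma> :: "real \<Rightarrow> complex"
  assumes curve: "billiard_curve \<gamma>" and equi: "equivariant \<gamma>"
begin

lemma curve_half_int: "\<gamma> (t + of_int i / 2) = (if even i then 1 else - 1) * \<gamma> t"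
proof (cases "even i")
  case True
  then obtain k where "i = 2 * k" by blast
  then have "\<gamma> (t + of_int i / 2) = \<gamma> t" by (simp add: curve_eq_iff[OF curve equi])
  with True show ?thesis by simp
next
  case False
  then obtain k where "i = 2 * k + 1" using oddE by blast
  then have "\<gamma> (t + of_int i / 2) = \<gamma> (t + 1/2)"
    by (simp add: curve_eq_iff[OF curve equi] add_divide_distrib)
  with False show ?thesis using curve_half[OF curve equi, of t] by simp
qed

lemma vel_half_int: "vel \<gamma> (t + of_int i / 2) = (if even i then 1 else - 1) * vel \<gamma> t"
proof -
  have "((\<lambda>t. t + of_int i / 2) has_vector_derivative 1) (at t)"
    by (auto intro!: derivative_eq_intros)
  from vector_diff_chain_at[OF this vel_deriv[OF curve equi]]
  have "((\<lambda>t. \<gamma> (t + of_int i / 2)) has_vector_derivative vel \<gamma> (t + of_int i / 2)) (at t)"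
    by (simp add: o_def)
  moreover have "((\<lambda>t. \<gamma> (t + of_int i / 2)) has_vector_derivative (if even i then 1 else - 1) * vel \<gamma> t) (at t)"
    unfolding curve_half_int by (intro has_vector_derivative_mult_right vel_deriv[OF curve equi])
  ultimately show ?thesis by (rule vector_derivative_unique_at)
qed

text \<open>The orbit has at most two points and is invariant under the half turn, so they are
  antipodal; conjugation must then fix or exchange them.\<close>

lemma symmetric_two_periodic:
  assumes Z: "periodic_seq Z 2" "symH Z = D2" and "Z 0 \<in> range \<gamma>"
  shows "Z i = (if even i then 1 else - 1) * Z 0" "cnj (Z 0) = Z 0 \<or> cnj (Z 0) = - Z 0"
proof -
  have per: "Z (j + 2) = Z j" for j
    using Z(1) by (simp add: periodic_seq_def)
  have Z_even: "Z (j + 2 * k) = Z j" for j k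
  proof (induction k rule: int_induct[where k = 0])
    case (step1 k)
    have "j + 2 * (k + 1) = (j + 2 * k) + 2" by simp
    with step1(2) show ?case by (simp only: per)
  next
    case (step2 k)
    have "j + 2 * k = (j + 2 * (k - 1)) + 2" by simp
    with step2(2) show ?case by (simp only: per)
  qed simp
  have Z_cases: "Z j = (if even j then Z 0 else Z 1)" for j
  proof (cases "even j")
    case True
    then show ?thesis using Z_even[of 0] by auto
  next
    case False
    then obtain k where "j = 2 * k + 1" using oddE by blast
    then show ?thesis using Z_even[of 1 k] by (simp add: add.commute)
  qed
  have sym: "\<exists>k. h (Z 0) = Z k" if "h \<in> D2" for h
  proof -
    from that have "h \<in> symH Z" by (simp only: Z(2))
    then obtain k where "(\<forall>i. h (Z i) = Z (k + i)) \<or> (\<forall>i. h (Z i) = Z (k - i))"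
      unfolding symH_def by blast
    then show ?thesis by (metis add.right_neutral diff_zero)
  qed
  have "- Z 0 \<noteq> Z 0"
    using assms(3) curve_nonzero[OF curve equi] by auto
  moreover have "\<exists>k. - Z 0 = Z k" "\<exists>k. cnj (Z 0) = Z k"
    using sym[of rotR] sym[of reflS] by (auto simp: D2_def rotR_def reflS_def)
  ultimately have "Z 1 = - Z 0" and c: "cnj (Z 0) = Z 0 \<or> cnj (Z 0) = Z 1"
    using Z_cases by metis+
  then show "Z i = (if even i then 1 else - 1) * Z 0" "cnj (Z 0) = Z 0 \<or> cnj (Z 0) = - Z 0"
    using Z_cases[of i] by auto
qed

text \<open>The hypothesis forces \<open>- 2 * t\<^sub>0\<close> to be a half-integer j/2, and the
  parity of j is the sign.\<close>

lemma reflected_parameter: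
  assumes "cnj (\<gamma> t\<^sub>0) = \<gamma> t\<^sub>0 \<or> cnj (\<gamma> t\<^sub>0) = - \<gamma> t\<^sub>0"
  obtains \<epsilon> where "\<epsilon> = 1 \<or> \<epsilon> = - 1" "\<And>t. \<gamma> (t\<^sub>0 - t) = \<epsilon> * cnj (\<gamma> (t\<^sub>0 + t))"
proof -
  have "\<gamma> (- t\<^sub>0) = \<gamma> t\<^sub>0 \<or> \<gamma> (- t\<^sub>0) = \<gamma> (t\<^sub>0 + 1/2)"
    using assms by (simp only: curve_minus[OF curve equi] curve_half[OF curve equi])
  then have "\<exists>j. - t\<^sub>0 - t\<^sub>0 = of_int j / 2"
  proof
    assume "\<gamma> (- t\<^sub>0) = \<gamma> t\<^sub>0"
    then have "- t\<^sub>0 - t\<^sub>0 \<in> \<int>" by (simp only: curve_eq_iff[OF curve equi])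
    then obtain k where "- t\<^sub>0 - t\<^sub>0 = of_int k" using Ints_cases by blast
    then show ?thesis by (intro exI[of _ "2 * k"]) simp
  next
    assume "\<gamma> (- t\<^sub>0) = \<gamma> (t\<^sub>0 + 1/2)"
    then have "- t\<^sub>0 - (t\<^sub>0 + 1/2) \<in> \<int>" by (simp only: curve_eq_iff[OF curve equi])
    then obtain k where "- t\<^sub>0 - (t\<^sub>0 + 1/2) = of_int k" using Ints_cases by blast
    then show ?thesis by (intro exI[of _ "2 * k + 1"]) (simp add: field_simps)
  qed
  then obtain j where j: "- t\<^sub>0 - t\<^sub>0 = of_int j / 2" by blast
  have "\<gamma> (t\<^sub>0 - t) = (if even j then 1 else - 1) * cnj (\<gamma> (t\<^sub>0 + t))" for t
  proof -
    have "\<gamma> (- (t\<^sub>0 + t)) = \<gamma> ((t\<^sub>0 - t) + of_int j / 2)" by (simp flip: j)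
    then have "cnj (\<gamma> (t\<^sub>0 + t)) = (if even j then 1 else - 1) * \<gamma> (t\<^sub>0 - t)"
      by (simp only: curve_half_int curve_minus[OF curve equi])
    then show ?thesis by simp
  qed
  then show thesis using that[of "if even j then 1 else - 1"] by auto
qed

end

section \<open>From an alternating chain to an orbit and its symmetries\<close>

locale symmetric_orbit = alternating_chain d s for d :: "int \<Rightarrow> real" and s :: int +
  fixes \<gamma> :: "real \<Rightarrow> complex" and t\<^sub>0 :: real and \<epsilon> :: complex
  assumes curve: "billiard_curve \<gamma>" and equi: "equivariant \<gamma>"
    and \<epsilon>: "\<gamma> (t\<^sub>0 - t) = \<epsilon> * cnj (\<gamma> (t\<^sub>0 + t))"
    and \<epsilon>_sign: "\<epsilon> = 1 \<or> \<epsilon> = - 1"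
    and bound: "\<bar>d i\<bar> < 1/4"
begin

definition \<omega> :: complex where "\<omega> = cnj (sgn (\<gamma> t\<^sub>0))"

sublocale oval: symmetric_oval "\<lambda>t. \<omega> * \<gamma> (t\<^sub>0 + t)" "\<lambda>t. \<omega> * vel \<gamma> (t\<^sub>0 + t)" "\<lambda>t. \<omega> * acc \<gamma> (t\<^sub>0 + t)"
  unfolding \<omega>_def by (rule symmetric_oval_normalized[OF curve equi \<epsilon>])

definition x :: "int \<Rightarrow> real" where "x i = t\<^sub>0 + of_int i / 2 + d i"

definition z :: "int \<Rightarrow> complex" where "z i = \<gamma> (x i)"

text \<open>The rotation that carries the normalised point with displacement \<open>d i\<close> back
  to the i-th impact point; its sign records the half turns.\<close>

definition \<eta> :: "int \<Rightarrow> complex" where "\<eta> i = cnj \<omega> * (if even i then 1 else - 1)"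

lemma \<omega>_unit: "\<omega> * cnj \<omega> = 1"
proof -
  have "cmod \<omega> = 1" using curve_nonzero[OF curve equi] by (simp add: \<omega>_def norm_sgn)
  then show ?thesis by (simp add: complex_norm_square[symmetric])
qed

lemma cnj_\<omega>: "cnj \<omega> = \<epsilon> * \<omega>"
proof -
  have e: "\<gamma> t\<^sub>0 = \<epsilon> * cnj (\<gamma> t\<^sub>0)" using \<epsilon>[of 0] by simp
  have "cnj \<omega> = \<gamma> t\<^sub>0 / cmod (\<gamma> t\<^sub>0)" by (simp add: \<omega>_def sgn_eq)
  also have "\<dots> = \<epsilon> * (cnj (\<gamma> t\<^sub>0) / cmod (\<gamma> t\<^sub>0))" by (subst e) simp
  also have "\<dots> = \<epsilon> * \<omega>" by (simp add: \<omega>_def sgn_eq)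
  finally show ?thesis .
qed

lemma \<eta>_unit: "cmod (\<eta> i) = 1"
proof -
  have "cmod \<omega> = 1" using curve_nonzero[OF curve equi] by (simp add: \<omega>_def norm_sgn)
  then show ?thesis by (simp add: \<eta>_def norm_mult)
qed

lemma \<eta>_add: "\<eta> (i + j) = (if even i then 1 else - 1) * \<eta> j"
  by (simp add: \<eta>_def)

lemma curve_\<eta>: "\<gamma> (t\<^sub>0 + of_int i / 2 + y) = \<eta> i * (\<omega> * \<gamma> (t\<^sub>0 + y))"
proof -
  have "\<gamma> (t\<^sub>0 + of_int i / 2 + y) = (if even i then 1 else - 1) * \<gamma> (t\<^sub>0 + y)"
    using curve_half_int[OF curve equi, of "t\<^sub>0 + y" i] by (simp add: add_ac)
  also have "\<dots> = \<omega> * cnj \<omega> * ((if even i then 1 else - 1) * \<gamma> (t\<^sub>0 + y))"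
    by (simp add: \<omega>_unit)
  finally show ?thesis by (simp add: \<eta>_def mult_ac)
qed

lemma vel_\<eta>: "vel \<gamma> (t\<^sub>0 + of_int i / 2 + y) = \<eta> i * (\<omega> * vel \<gamma> (t\<^sub>0 + y))"
proof -
  have "vel \<gamma> (t\<^sub>0 + of_int i / 2 + y) = (if even i then 1 else - 1) * vel \<gamma> (t\<^sub>0 + y)"
    using vel_half_int[OF curve equi, of "t\<^sub>0 + y" i] by (simp add: add_ac)
  also have "\<dots> = \<omega> * cnj \<omega> * ((if even i then 1 else - 1) * vel \<gamma> (t\<^sub>0 + y))"
    by (simp add: \<omega>_unit)
  finally show ?thesis by (simp add: \<eta>_def mult_ac)
qed

lemma z_eq: "z i = \<eta> i * (\<omega> * \<gamma> (t\<^sub>0 + d i))"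
  by (simp add: z_def x_def curve_\<eta>)

lemma diff_z: "z (i + 1) - z i = - \<eta> i * (\<omega> * \<gamma> (t\<^sub>0 + d i) + \<omega> * \<gamma> (t\<^sub>0 + d (i + 1)))"
  using \<eta>_add[of 1 i] by (simp add: z_eq add.commute algebra_simps)

lemma z_neq: "z i \<noteq> z (i + 1)"
proof -
  have "0 < Re (\<omega> * \<gamma> (t\<^sub>0 + d i))" "0 < Re (\<omega> * \<gamma> (t\<^sub>0 + d (i + 1)))"
    using oval.Re_pos bound by blast+
  then have "0 < Re (\<omega> * \<gamma> (t\<^sub>0 + d i) + \<omega> * \<gamma> (t\<^sub>0 + d (i + 1)))"
    by (simp only: plus_complex.sel add_pos_pos)
  then have "\<omega> * \<gamma> (t\<^sub>0 + d i) + \<omega> * \<gamma> (t\<^sub>0 + d (i + 1)) \<noteq> 0"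
    by (metis less_irrefl zero_complex.sel(1))
  moreover have "\<eta> i \<noteq> 0" using \<eta>_unit[of i] by auto
  ultimately have "z (i + 1) - z i \<noteq> 0" unfolding diff_z by simp
  then show ?thesis by simp
qed

lemma is_lift_x: "is_lift \<gamma> z x"
proof -
  have "0 < x (i + 1) - x i \<and> x (i + 1) - x i < 1" for i
  proof -
    have "x (i + 1) - x i = 1/2 + d (i + 1) - d i" by (simp add: x_def add_divide_distrib)
    then show ?thesis using bound[of i] bound[of "i + 1"] by linarith
  qed
  then show ?thesis by (simp add: is_lift_def z_def)
qed

lemma x_Xpq: "x \<in> Xpq (2 * s) s"
  using period[of _ 1] by (simp add: Xpq_def x_def add_divide_distrib)

lemma rotation_number_z: "rotation_number \<gamma> z (1/2)"
proof -
  have "(\<lambda>n. (t\<^sub>0 + d (int n)) / real n) \<longlonglongrightarrow> 0"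
  proof (rule Lim_null_comparison)
    have "norm ((t\<^sub>0 + d (int n)) / real n) \<le> (\<bar>t\<^sub>0\<bar> + 1) / real n" for n
      using bound[of "int n"] by (auto simp: abs_le_iff intro!: divide_right_mono)
    then show "\<forall>\<^sub>F n in sequentially. norm ((t\<^sub>0 + d (int n)) / real n) \<le> (\<bar>t\<^sub>0\<bar> + 1) / real n"
      by simp
    show "(\<lambda>n. (\<bar>t\<^sub>0\<bar> + 1) / real n) \<longlonglongrightarrow> 0"
      by (rule lim_const_over_n)
  qed
  then have "(\<lambda>n. 1/2 + (t\<^sub>0 + d (int n)) / real n) \<longlonglongrightarrow> 1/2 + 0"
    by (intro tendsto_intros)
  moreover have "\<forall>\<^sub>F n in sequentially. 1/2 + (t\<^sub>0 + d (int n)) / real n = x (int n) / real n"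
    using eventually_gt_at_top[of 0] by eventually_elim (simp add: x_def field_simps)
  ultimately have "(\<lambda>n. x (int n) / real n) \<longlonglongrightarrow> 1/2"
    using tendsto_cong by fastforce
  then show ?thesis
    unfolding rotation_number_def using is_lift_x by blast
qed

lemma offset_eqD: "\<omega> * \<gamma> (t\<^sub>0 + d i) = \<omega> * \<gamma> (t\<^sub>0 + d j) \<Longrightarrow> d i = d j"
proof -
  assume "\<omega> * \<gamma> (t\<^sub>0 + d i) = \<omega> * \<gamma> (t\<^sub>0 + d j)"
  then have "d i - d j \<in> \<int>" by (rule oval.g_eqD)
  moreover have "\<bar>d i - d j\<bar> < 1" using bound[of i] bound[of j] by linarith
  ultimately show ?thesis by (metis Ints_eq_abs_less1 Ints_0 diff_0_right eq_iff_diff_eq_0)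
qed

text \<open>All normalised points have positive real part, so the sign can be recovered;
  displacements below 1/4 are then determined by their points.\<close>

lemma z_sign_eqD:
  assumes "z i = (if even m then 1 else - 1) * \<eta> i * (\<omega> * \<gamma> (t\<^sub>0 + d j))"
  shows "even m" "d i = d j"
proof -
  have "\<eta> i \<noteq> 0" using \<eta>_unit[of i] by auto
  with assms have eq: "\<omega> * \<gamma> (t\<^sub>0 + d i) = (if even m then 1 else - 1) * (\<omega> * \<gamma> (t\<^sub>0 + d j))"
    by (auto simp: z_eq split: if_splits)
  have Re: "0 < Re (\<omega> * \<gamma> (t\<^sub>0 + d i))" "0 < Re (\<omega> * \<gamma> (t\<^sub>0 + d j))"
    using oval.Re_pos bound by blast+
  show "even m"
  proof (rule ccontr)
    assume "odd m"
    with eq have "Re (\<omega> * \<gamma> (t\<^sub>0 + d i)) = - Re (\<omega> * \<gamma> (t\<^sub>0 + d j))" by simp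
    with Re show False by linarith
  qed
  with eq show "d i = d j" by (intro offset_eqD) simp
qed

lemma periodic_dvd:
  assumes "periodic_seq z q"
  shows "2 * s dvd q"
proof (rule period_dvd)
  show "d (i + q) = d i" for i
  proof -
    have "z i = z (q + i)"
      using assms by (simp add: periodic_seq_def add.commute)
    also have "\<dots> = (if even q then 1 else - 1) * \<eta> i * (\<omega> * \<gamma> (t\<^sub>0 + d (q + i)))"
      by (simp only: z_eq \<eta>_add)
    finally show ?thesis using z_sign_eqD(2) by (metis add.commute)
  qed
qed

lemma minimal_period_z: "minimal_period z (2 * s)"
  unfolding minimal_period_def
proof (intro conjI allI impI)
  show "0 < 2 * s" using s by simp
  show "periodic_seq z (2 * s)"
    using period[of _ 1] \<eta>_add[of "2 * s"] by (simp add: periodic_seq_def z_eq add.commute)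
  show "\<not> periodic_seq z q" if "0 < q \<and> q < 2 * s" for q
    using periodic_dvd[of q] zdvd_imp_le that by fastforce
qed

text \<open>Comparing y (i+2) with y i + 1 amounts to comparing d (i+2) with d i. The Birkhoff
  property makes the comparison go the same way for all i, periodicity makes it an equality, and 2
  would be a period of \<open>d\<close>.\<close>

lemma not_birkhoff_z: "\<not> birkhoff_seq \<gamma> z"
proof
  assume "birkhoff_seq \<gamma> z"
  then obtain y where y: "is_lift \<gamma> z y" "birkhoff y"
    unfolding birkhoff_seq_def by blast
  have "y i - x i \<in> \<int>" for i
    using y(1) is_lift_x curve_eq_iff[OF curve equi] by (metis is_lift_def)
  then have "\<exists>m. y i - x i = of_int m" for i
    by (meson Ints_cases)
  then obtain m where "\<And>i. y i - x i = of_int (m i)"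
    by metis
  then have m: "y i = x i + of_int (m i)" for i
    by (metis add.commute diff_add_cancel)
  \<comment> \<open>Increments of both lifts lie in (0,1), so the integer offset is
    constant.\<close>
  have "m (i + 1) = m i" for i
  proof -
    have "\<bar>real_of_int (m (i + 1)) - real_of_int (m i)\<bar> < 1"
      using y(1) is_lift_x m[of i] m[of "i + 1"] unfolding is_lift_def by (smt (verit))
    then show ?thesis by linarith
  qed
  then have "m (i + 2) = m i" for i
    by (metis add.assoc one_add_one)
  then have y2: "y (i + 2) = y i + 1 + (d (i + 2) - d i)" for i
    by (simp add: m x_def add_divide_distrib)
  have iter: "d (i + 2) = d i" if mono: "\<And>i. c * d (i + 2) \<le> c * d i" and "c \<noteq> 0" for c :: real and i
  proof -
    have le: "c * d (i + 2 * int n) \<le> c * d i" for i n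
    proof (induction n)
      case (Suc n)
      then show ?case using mono[of "i + 2 * int n"] by (simp add: algebra_simps)
    qed simp
    \<comment> \<open>From i + 2, another s - 1 double steps lead to i + 2s, which closes the cycle
      of inequalities. The factor c = 1 or -1 treats both directions at once.\<close>
    have "c * d i \<le> c * d (i + 2)"
      using le[of "i + 2" "nat (s - 1)"] period[of i 1] s by (simp add: algebra_simps)
    with mono[of i] that(2) show ?thesis by simp
  qed
  have "\<forall>i. d (i + 2) = d i"
  proof (cases "d 2 \<le> d 0")
    case True
    then have "y 2 \<le> y 0 + of_int 1" using y2[of 0] by simp
    then have "y (2 + i) \<le> y (0 + i) + of_int 1" for i
      using y(2) unfolding birkhoff_def by blast
    then show ?thesis using iter[of 1] y2 by (simp add: add.commute)
  next
    case False
    then have "y 0 \<le> y 2 + of_int (- 1)" using y2[of 0] by simp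
    then have "y (0 + i) \<le> y (2 + i) + of_int (- 1)" for i
      using y(2) unfolding birkhoff_def by blast
    then show ?thesis using iter[of "- 1"] y2 by (simp add: add.commute)
  qed
  then have "2 * s dvd 2" by (intro period_dvd) simp
  then show False using s zdvd_imp_le[of "2 * s" 2] by simp
qed

text \<open>\<open>w \<mapsto> \<epsilon> * cnj w\<close> is the reflection fixing
  \<open>Z 0\<close>. Moving s indices also applies s half turns, so for odd \<open>s\<close> the
  reflection in the perpendicular axis appears instead.\<close>

definition \<sigma> :: "complex \<Rightarrow> complex" where
  "\<sigma> = (if \<epsilon> * (if even s then 1 else - 1) = 1 then reflS else reflRS)"

lemma \<sigma>_eq: "\<sigma> w = \<epsilon> * (if even s then 1 else - 1) * cnj w"
  using \<epsilon>_sign by (auto simp: \<sigma>_def reflS_def reflRS_def rotR_def)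

lemma \<sigma>_cases: "\<sigma> \<in> {reflS, reflRS}"
  by (simp add: \<sigma>_def)

text \<open>Translation by \<open>s\<close> negates the displacement, which is conjugation in the
  normalised picture.\<close>

lemma \<sigma>_z: "\<sigma> (z i) = z (s + i)"
proof -
  have "z (s + i) = (if even s then 1 else - 1) * \<eta> i * (\<omega> * \<gamma> (t\<^sub>0 + - d i))"
    unfolding z_eq \<eta>_add using shift[of i] by (simp add: add.commute)
  also have "\<omega> * \<gamma> (t\<^sub>0 + - d i) = cnj (\<omega> * \<gamma> (t\<^sub>0 + d i))"
    by (rule oval.g_minus)
  finally have "z (s + i) = (if even s then 1 else - 1) * (\<epsilon> * cnj (\<eta> i)) * cnj (\<omega> * \<gamma> (t\<^sub>0 + d i))"
    using \<epsilon>_sign cnj_\<omega> by (auto simp: \<eta>_def)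
  then show ?thesis by (simp only: \<sigma>_eq z_eq[of i] complex_cnj_mult mult_ac)
qed

lemma \<sigma>_z_reversing: "\<sigma> (z i) = z (s - i)"
proof -
  have "z (s - i) = z (s + i)"
    using \<eta>_add[of s "- i"] \<eta>_add[of s i] anti[of i] shift[of i] by (simp add: z_eq \<eta>_def add.commute)
  then show ?thesis by (simp add: \<sigma>_z)
qed

text \<open>The sign of a half turn needs an odd index shift k. But k would be a period of
  \<open>d\<close>, with evenness absorbing time reversal, hence a multiple of 2s.\<close>

lemma rotR_notin_symH: "rotR \<notin> symH z"
proof
  assume "rotR \<in> symH z"
  then obtain k where "(\<forall>i. rotR (z i) = z (k + i)) \<or> (\<forall>i. rotR (z i) = z (k - i))"
    unfolding symH_def by blast
  then have "\<exists>\<delta>. (\<delta> = 1 \<or> \<delta> = - 1) \<and> (\<forall>i. rotR (z i) = z (k + \<delta> * i))"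
    by (metis add_uminus_conv_diff mult_1 mult_minus1)
  then obtain \<delta> where \<delta>: "\<delta> = 1 \<or> \<delta> = - 1" "\<And>i. rotR (z i) = z (k + \<delta> * i)" by blast
  have z: "z i = (if even (k + 1) then 1 else - 1) * \<eta> i * (\<omega> * \<gamma> (t\<^sub>0 + d (k + \<delta> * i)))" for i
  proof -
    have "\<eta> (\<delta> * i) = \<eta> i" using \<delta>(1) by (auto simp: \<eta>_def)
    then have "- z i = (if even k then 1 else - 1) * \<eta> i * (\<omega> * \<gamma> (t\<^sub>0 + d (k + \<delta> * i)))"
      using \<delta>(2)[of i] by (simp only: rotR_def z_eq[of "k + \<delta> * i"] \<eta>_add)
    then show ?thesis by (simp add: minus_equation_iff[of "z i"] split: if_splits)
  qed
  have "odd k" using z_sign_eqD(1)[OF z] by simp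
  have "d (i + k) = d i" for i
    using z_sign_eqD(2)[OF z, of "\<delta> * i"] \<delta>(1) even[of i] by (auto simp: add.commute)
  then have "2 * s dvd k" by (rule period_dvd)
  with \<open>odd k\<close> show False using dvd_mult_left by blast
qed

text \<open>If the other reflection were a symmetry, composing it with \<open>\<sigma>\<close> would
  give the half turn.\<close>

lemma symH_z: "symH z = {id, \<sigma>}"
proof -
  have "\<sigma> \<in> D2" using \<sigma>_cases by (auto simp: D2_def)
  then have \<sigma>: "\<sigma> \<in> symH z" unfolding symH_def using \<sigma>_z by blast
  have "id \<in> symH z" unfolding symH_def D2_def by (auto intro!: exI[of _ 0])
  moreover have "rotR \<circ> \<sigma> \<notin> symH z"
  proof
    assume "rotR \<circ> \<sigma> \<in> symH z"
    then obtain k where k: "(\<forall>i. rotR (\<sigma> (z i)) = z (k + i)) \<or> (\<forall>i. rotR (\<sigma> (z i)) = z (k - i))"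
      unfolding symH_def by auto
    have "rotR (z i) = rotR (\<sigma> (z (i - s)))" for i
      using \<sigma>_z[of "i - s"] by simp
    with k have "(\<forall>i. rotR (z i) = z ((k - s) + i)) \<or> (\<forall>i. rotR (z i) = z ((k + s) - i))"
      by (auto simp: algebra_simps)
    then have "rotR \<in> symH z" unfolding symH_def D2_def by blast
    with rotR_notin_symH show False ..
  qed
  moreover have "D2 \<subseteq> {id, rotR, \<sigma>, rotR \<circ> \<sigma>}"
    by (auto simp: D2_def \<sigma>_def reflRS_def rotR_def fun_eq_iff o_def)
  moreover have "symH z \<subseteq> D2" by (auto simp: symH_def)
  ultimately show ?thesis using \<sigma> rotR_notin_symH by blast
qed

lemma billiard_orbit_z:
  assumes crit: "\<And>i. oval.chord' (d (i - 1)) (d i) + oval.chord' (d (i + 1)) (d i) = 0"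
  shows "billiard_orbit \<gamma> z"
  unfolding billiard_orbit_def billiard_seq_def
proof (intro conjI allI)
  show "z i \<in> range \<gamma>" for i by (simp add: z_def)
  show "z i \<noteq> z (i + 1)" for i by (rule z_neq)
  fix i
  show "\<exists>t. \<gamma> t = z i \<and>
      sgn (z (i + 1) - z i) = (sgn (vel \<gamma> t))\<^sup>2 * cnj (sgn (z i - z (i - 1)))"
  proof (intro exI conjI)
    show "\<gamma> (x i) = z i" by (simp add: z_def)
    define U where "U = sgn (\<omega> * \<gamma> (t\<^sub>0 + d (i - 1)) + \<omega> * \<gamma> (t\<^sub>0 + d i))"
    define \<tau> where "\<tau> = sgn (\<omega> * vel \<gamma> (t\<^sub>0 + d i))"
    have sgn_\<eta>: "sgn (\<eta> i) = \<eta> i" using \<eta>_unit by (simp add: sgn_eq)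
    have "\<eta> (i - 1) = - \<eta> i" by (simp add: \<eta>_def)
    then have "sgn (z i - z (i - 1)) = \<eta> i * U"
      using diff_z[of "i - 1"] by (simp add: sgn_mult sgn_\<eta> U_def)
    moreover have "sgn (z (i + 1) - z i) = \<eta> i * (\<tau>\<^sup>2 * cnj U)"
      using oval.reflection[OF bound bound bound crit, of i]
      by (simp add: diff_z sgn_mult sgn_minus sgn_\<eta> U_def \<tau>_def)
    moreover have "sgn (vel \<gamma> (x i)) = \<eta> i * \<tau>"
      by (simp add: x_def vel_\<eta> sgn_mult[of "\<eta> i"] sgn_\<eta> \<tau>_def)
    moreover have "\<eta> i * cnj (\<eta> i) = 1" using \<eta>_unit[of i] by (simp add: complex_norm_square[symmetric])
    moreover have "(\<eta> i * \<tau>)\<^sup>2 * cnj (\<eta> i * U) = \<eta> i * cnj (\<eta> i) * (\<eta> i * (\<tau>\<^sup>2 * cnj U))"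
      by (simp add: power2_eq_square mult_ac)
    ultimately show "sgn (z (i + 1) - z i) = (sgn (vel \<gamma> (x i)))\<^sup>2 * cnj (sgn (z i - z (i - 1)))"
      by (simp only: mult_1)
  qed
qed

end

theorem mainTheorem3:
  fixes \<gamma> :: "real \<Rightarrow> complex" and Z :: "int \<Rightarrow> complex" and s :: int
  assumes "billiard_curve \<gamma>" and "equivariant \<gamma>"
    and "billiard_orbit \<gamma> Z" and "periodic_seq Z 2" and "birkhoff_seq \<gamma> Z"
    and "symH Z = D2"
    and "s \<ge> 2"
    and "curv_at \<gamma> (Z 0) * cmod (Z 1 - Z 0) < 2 * (cos (pi / real_of_int (2 * s)))\<^sup>2"
  shows "\<exists>z. billiard_orbit \<gamma> z \<and> \<not> birkhoff_seq \<gamma> z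
           \<and> minimal_period z (2 * s) \<and> rotation_number \<gamma> z (1/2)
           \<and> (\<exists>\<sigma>\<in>{reflS, reflRS}. symH z = {id, \<sigma>}
                \<and> (\<forall>i. \<sigma> (z i) = z (s + i))
                \<and> (\<exists>k. \<forall>i. \<sigma> (z i) = z (k - i)))
           \<and> (\<exists>x X. is_lift \<gamma> z x \<and> is_lift \<gamma> Z X
                \<and> x \<in> Xpq (2 * s) s \<and> X \<in> Xpq (2 * s) s
                \<and> sign_changes (\<lambda>i. x i - X i) (2 * s) = 2)"
proof -
  note curve = assms(1) and equi = assms(2)
  have Z0: "Z 0 \<in> range \<gamma>" using assms(3) by (simp add: billiard_orbit_def billiard_seq_def)
  note Z = symmetric_two_periodic[OF curve equi assms(4,6) Z0]
  \<comment> \<open>the choice made by \<open>curv_at\<close>, so that periodicity of the curvature is not needed\<close>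
  define t\<^sub>0 where "t\<^sub>0 = (SOME t. \<gamma> t = Z 0)"
  have t\<^sub>0: "\<gamma> t\<^sub>0 = Z 0" unfolding t\<^sub>0_def using Z0 by (metis (mono_tags) imageE someI)
  obtain \<epsilon> where \<epsilon>: "\<epsilon> = 1 \<or> \<epsilon> = - 1" "\<And>t. \<gamma> (t\<^sub>0 - t) = \<epsilon> * cnj (\<gamma> (t\<^sub>0 + t))"
    using reflected_parameter[OF curve equi, of t\<^sub>0] Z(2) unfolding t\<^sub>0 by metis
  define \<omega> where "\<omega> = cnj (sgn (\<gamma> t\<^sub>0))"
  interpret oval: symmetric_oval "\<lambda>t. \<omega> * \<gamma> (t\<^sub>0 + t)" "\<lambda>t. \<omega> * vel \<gamma> (t\<^sub>0 + t)" "\<lambda>t. \<omega> * acc \<gamma> (t\<^sub>0 + t)"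
    unfolding \<omega>_def by (rule symmetric_oval_normalized[OF curve equi \<epsilon>(2)])
  have \<omega>: "cmod \<omega> = 1" using curve_nonzero[OF curve equi] by (simp add: \<omega>_def norm_sgn)
  have "\<omega> * \<gamma> t\<^sub>0 = cmod (\<gamma> t\<^sub>0)"
    using curve_nonzero[OF curve equi, of "t\<^sub>0"] complex_norm_square[of "\<gamma> t\<^sub>0"]
    by (simp add: \<omega>_def sgn_eq mult.commute power2_eq_square divide_eq_eq)
  then have radius: "cmod (Z 1 - Z 0) = 2 * Re (\<omega> * \<gamma> (t\<^sub>0 + 0))"
    using Z(1)[of 1] t\<^sub>0 by (simp add: norm_minus_commute flip: norm_mult)
  \<comment> \<open>Curvature is invariant under the rotation, and the velocity there is purely
    imaginary.\<close>
  have curvature: "curv_at \<gamma> (Z 0) = - Re (\<omega> * acc \<gamma> (t\<^sub>0 + 0)) / (Im (\<omega> * vel \<gamma> (t\<^sub>0 + 0)))\<^sup>2"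
  proof -
    define v a where "v = \<omega> * vel \<gamma> t\<^sub>0" and "a = \<omega> * acc \<gamma> t\<^sub>0"
    have v: "Re v = 0" "0 < Im v"
      using oval.Re_g1_0 oval.Im_g1_0 by (simp_all only: v_def add_0_right)
    have "cmod v = Im v" using v by (simp add: cmod_def)
    have "\<omega> * cnj \<omega> = 1" using \<omega> by (simp add: complex_norm_square[symmetric])
    moreover have "cnj v * a = \<omega> * cnj \<omega> * (cnj (vel \<gamma> t\<^sub>0) * acc \<gamma> t\<^sub>0)"
      by (simp add: v_def a_def mult_ac)
    moreover have "cmod (vel \<gamma> t\<^sub>0) = cmod v" using \<omega> by (simp add: v_def norm_mult)
    ultimately have "curv_at \<gamma> (Z 0) = Im (cnj v * a) / cmod v ^ 3"
      by (simp only: curv_at_def curv_def t\<^sub>0_def[symmetric] mult_1)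
    also have "\<dots> = - Re a / (Im v)\<^sup>2"
      using v \<open>cmod v = Im v\<close> by (simp add: power2_eq_square power3_eq_cube)
    finally show ?thesis by (simp only: v_def a_def add_0_right)
  qed
  obtain d where d: "alternating_chain d s" "\<And>i. \<bar>d i\<bar> < 1/4"
    "\<And>i. oval.chord' (d (i - 1)) (d i) + oval.chord' (d (i + 1)) (d i) = 0"
    using oval.symmetric_critical_chain[OF assms(7) assms(8)[unfolded radius curvature]] by blast
  interpret alternating_chain d s by (rule d)
  interpret orbit: symmetric_orbit d s \<gamma> t\<^sub>0 \<epsilon>
    using curve equi \<epsilon> d(2) by unfold_locales auto
  have "orbit.\<omega> = \<omega>" by (simp add: orbit.\<omega>_def \<omega>_def)
  then have "billiard_orbit \<gamma> orbit.z"
    using orbit.billiard_orbit_z d(3) by simp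
  moreover define X where "X i = t\<^sub>0 + real_of_int i / 2" for i :: int
  moreover have "is_lift \<gamma> Z X"
  proof -
    have "\<gamma> (X i) = Z i" for i
      by (simp only: X_def curve_half_int[OF curve equi] t\<^sub>0 Z(1)[of i])
    then show ?thesis by (simp add: is_lift_def X_def add_divide_distrib)
  qed
  moreover have "X \<in> Xpq (2 * s) s"
    by (simp add: Xpq_def X_def add_divide_distrib)
  moreover have "(\<lambda>i. orbit.x i - X i) = d" by (simp add: orbit.x_def X_def)
  ultimately show ?thesis
    using orbit.not_birkhoff_z orbit.minimal_period_z orbit.rotation_number_z orbit.\<sigma>_cases orbit.symH_z
      orbit.\<sigma>_z orbit.\<sigma>_z_reversing orbit.is_lift_x orbit.x_Xpq sign_changes_eq_2
    by (intro exI[of _ orbit.z] conjI bexI[of _ orbit.\<sigma>] exI[of _ s] exI[of _ orbit.x] exI[of _ X] allI) simp_all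
qed

end
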